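(* Let $A\in \operatorname{Mat}_r(\mathbb{C}[t])$ be nonsingular. Assume that either (1) $A$ is not diagonalizable over the algebraic closure of $\mathbb{C}(t)$, or (2) $A$ has two eigenvalues (in the algebraic closure of $\mathbb{C}(t)$) that are multiplicatively independent. Then there exists a polynomial $h\in\mathbb{C}[t]$ such that $\gcd(A^k-I)$ divides $h$ for every $k\geq 1$. If, in addition, $A$ is primitive, then $A^k$ is primitive for all $k\geq 1$ outside a finite union of proper arithmetic progressions $d_i\mathbb{N}$ with $d_i\geq 2$.
   Context: For $A\in\operatorname{Mat}_r(\mathbb{C}[t])$, $\gcd(A-I)$ denotes the (monic) greatest common divisor in $\mathbb{C}[t]$ of the entries of $A-I$; $A$ is primitive if $\gcd(A-I)=1$. Two elements $\lambda,\mu$ are multiplicatively independent if $\lambda^r\neq\mu^s$ for all integers $r,s\geq1$.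
   Formalization: Multiplicative independence is taken in the standard sense: λ^r ≠ μ^s for all integers (r,s) ≠ (0,0); with only r,s ≥ 1 the claim fails, e.g. for diag(1,t), where gcd(A^k−I) = t^k−1. The polynomial h is required to be nonzero. *)

theory Defs
  imports
    "HOL-Computational_Algebra.Computational_Algebra"
    "HOL-Computational_Algebra.Field_as_Ring"
    "HOL-Algebra.Algebraic_Closure_Type"
    "Jordan_Normal_Form.Char_Poly"
begin

text \<open>The algebraic closure of the field of rational functions \<open>\<complex>(t)\<close>, where \<open>\<complex>(t)\<close> is the
  fraction field of \<open>\<complex>[t]\<close>.\<close>

type_synonym ratfun_closure = "complex poly fract alg_closure"

definition to_ratfun_closure :: "complex poly \<Rightarrow> ratfun_closure" where
  "to_ratfun_closure p = to_ac (Fract p 1)"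

definition diagonalizable_mat :: "'a :: field mat \<Rightarrow> bool" where
  "diagonalizable_mat A \<longleftrightarrow> (\<exists>D. diagonal_mat D \<and> similar_mat A D)"

text \<open>On \<open>\<complex>[t]\<close> the library \<open>Gcd\<close> is normalized, i.e. monic unless it is zero.\<close>

definition mat_gcd :: "complex poly mat \<Rightarrow> complex poly" where
  "mat_gcd A = Gcd (elements_mat A)"

definition primitive_mat :: "complex poly mat \<Rightarrow> bool" where
  "primitive_mat A \<longleftrightarrow> mat_gcd (A - 1\<^sub>m (dim_row A)) = 1"

text \<open>The exponents are arbitrary integers, not both zero. Excluding only relations
  \<open>\<lambda>\<^sup>r = \<mu>\<^sup>s\<close> with \<open>r, s \<ge> 1\<close> would be too weak: it would count as independent the pair
  \<open>1, t\<close>, for which \<open>diag(1, t)\<^sup>k - I\<close> has gcd \<open>t\<^sup>k - 1\<close>, and also any pair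
  \<open>\<lambda>, \<lambda>\<^sup>-\<^sup>1\<close> with \<open>\<lambda>\<close> not a root of unity.\<close>

definition mult_independent :: "'a :: field \<Rightarrow> 'a \<Rightarrow> bool" where
  "mult_independent x y \<longleftrightarrow>
     (\<forall>(r :: int) (s :: int). \<not> (r = 0 \<and> s = 0) \<longrightarrow> x powi r \<noteq> y powi s)"

end

theory Submission
  imports
    Defs
    "Subresultants.Subresultant_Gcd"
    "HOL-Number_Theory.Number_Theory"
    "Jordan_Normal_Form.Jordan_Normal_Form_Existence"
begin

text \<open>Call \<open>z\<close> exceptional if \<open>A(z)\<^sup>k = I\<close> for some \<open>k \<ge> 1\<close>, and let \<open>d\<^sub>z\<close> be the least such \<open>k\<close>.
  The roots of \<open>gcd(A\<^sup>k - I)\<close> are the exceptional \<open>z\<close> with \<open>d\<^sub>z dvd k\<close>, and the multiplicity of \<open>z\<close> does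
  not depend on \<open>k\<close>: for \<open>B = A^d\<^sub>z\<close> the cofactor \<open>I + B + \<dots> + B\<^sup>q\<^sup>-\<^sup>1\<close> of \<open>B - I\<close> in \<open>B\<^sup>q - I\<close>
  specializes to \<open>q I\<close> at \<open>z\<close>. So everything reduces to the finiteness of the exceptional set.

  If \<open>A\<close> is not diagonalizable and \<open>f\<close> is the radical of its characteristic polynomial in
  \<open>\<complex>[t][x]\<close>, then \<open>f(A) \<noteq> 0\<close>, while \<open>f(A)\<close> vanishes at exceptional points because matrices of finite
  order are diagonalizable.

  If \<open>\<alpha>, \<beta>\<close> are multiplicatively independent eigenvalues, let \<open>F(x, y)\<close> be the irreducible relation
  between them; an exceptional point yields a torsion point on the curve \<open>F = 0\<close>, and there are only
  finitely many (Ihara, Serre, Tate). Following Lang: a torsion point of order \<open>n\<close> has at least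
  \<open>c n\<^sup>3\<^sup>/\<^sup>4\<close> conjugates on the curve, by irreducibility of cyclotomic polynomials, but they all
  satisfy one monomial relation of degree at most \<open>\<surd>n\<close>, which by elimination leaves room for only
  \<open>O(\<surd>n)\<close> points.\<close>

section \<open>Conjugates of roots of unity\<close>

text \<open>Pseudo-division by a vanishing polynomial of least degree leaves a remainder that
  vanishes too, hence is 0. Passing to the primitive part of the divisor lets Gauss's lemma cancel
  the multiplier. This supplies minimal polynomials over Z and C[t], and the relation between two
  eigenvalues.\<close>

lemma vanishing_ideal_principal:
  fixes hom :: "'r :: {factorial_ring_gcd, semiring_gcd_mult_normalize} \<Rightarrow> 'k :: field"
  assumes "inj_comm_ring_hom hom" and "q0 \<noteq> 0" and "poly (map_poly hom q0) a = 0"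
  obtains p where "\<And>q. poly (map_poly hom q) a = 0 \<longleftrightarrow> p dvd q"
proof -
  interpret inj_comm_ring_hom hom by fact
  interpret map: map_poly_inj_comm_ring_hom hom ..
  define P where "P = (\<lambda>q. q \<noteq> 0 \<and> poly (map_poly hom q) a = 0)"
  obtain p0 where p0: "P p0" and min: "\<And>q. P q \<Longrightarrow> degree p0 \<le> degree q"
    using arg_min_nat_lemma[of P q0 degree] assms(2,3) unfolding P_def by blast
  define p where "p = primitive_part p0"
  have p0_nz: "p0 \<noteq> 0" using p0 by (auto simp: P_def)
  have "poly (map_poly hom p0) a = hom (content p0) * poly (map_poly hom p) a"
    by (subst content_times_primitive_part[of p0, symmetric], subst p_def[symmetric])
       (simp add: hom_distribs)
  hence pa: "poly (map_poly hom p) a = 0" using p0 p0_nz by (auto simp: P_def)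
  have p_nz: "p \<noteq> 0" using p0_nz by (simp add: p_def)
  have "poly (map_poly hom q) a = 0 \<longleftrightarrow> p dvd q" for q
  proof
    assume "p dvd q"
    then obtain s where "q = p * s" ..
    thus "poly (map_poly hom q) a = 0" using pa by (simp add: hom_distribs)
  next
    assume q: "poly (map_poly hom q) a = 0"
    define r where "r = pseudo_mod q p"
    obtain c s where c: "c \<noteq> 0" "smult c q = p * s + r"
      using pseudo_mod(1)[OF p_nz, of q] unfolding r_def by blast
    have "r = smult c q - p * s" using c by simp
    hence "poly (map_poly hom r) a = 0" using q pa by (simp add: hom_distribs)
    moreover have "r = 0 \<or> degree r < degree p" unfolding r_def by (rule pseudo_mod(2)[OF p_nz])
    ultimately have "r = 0" using min[of r] unfolding P_def p_def degree_primitive_part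
      by (meson not_le)
    hence "p dvd smult c q" using c by simp
    then obtain k where "smult c q = p * k" ..
    hence "fract_poly (smult c q) = fract_poly p * fract_poly k" by simp
    hence "fract_poly p dvd fract_poly (smult c q)" by (metis dvd_triv_left)
    hence "fract_poly p dvd fract_poly q" using c(1)
      by (simp add: fract_poly_smult dvd_smult_iff)
    thus "p dvd q" by (rule fract_poly_dvdD) (simp add: p_def p0_nz)
  qed
  thus ?thesis by (rule that)
qed

lemma prime_dvd_power_add_diff:
  fixes u v :: "'a :: comm_ring_1"
  assumes "prime p"
  shows "of_nat p dvd (u + v) ^ p - u ^ p - v ^ p"
proof -
  have p: "p > 1" using assms prime_gt_1_nat by blast
  have "(u + v) ^ p = (\<Sum>k\<le>p. of_nat (p choose k) * u ^ k * v ^ (p - k))"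
    by (rule binomial_ring)
  also have "{..p} = insert 0 (insert p {0<..<p})" using p by auto
  also have "(\<Sum>k\<in>\<dots>. of_nat (p choose k) * u ^ k * v ^ (p - k)) =
      v ^ p + u ^ p + (\<Sum>k\<in>{0<..<p}. of_nat (p choose k) * u ^ k * v ^ (p - k))"
    using p by simp
  finally have *: "(u + v) ^ p - u ^ p - v ^ p =
      (\<Sum>k\<in>{0<..<p}. of_nat (p choose k) * u ^ k * v ^ (p - k))" by simp
  have "(of_nat p :: 'a) dvd of_nat (p choose k)" if "k \<in> {0<..<p}" for k
  proof -
    have "p dvd (p choose k)" using that assms by (intro dvd_choose_prime) auto
    thus ?thesis by (metis dvdE dvd_triv_left of_nat_mult)
  qed
  thus ?thesis unfolding * by (intro dvd_sum) (auto simp: mult.assoc)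
qed

text \<open>Frobenius on F_p[x]: p-th powers are additive modulo \<open>p\<close>, and Fermat's
  theorem fixes the coefficients.\<close>

lemma int_poly_power_prime_cong:
  fixes h :: "int poly"
  assumes "prime p"
  shows "[:int p:] dvd h ^ p - pcompose h (monom 1 p)"
proof (induction h)
  case 0
  show ?case using assms prime_gt_0_nat[of p] by (simp add: power_0_left)
next
  case (pCons a h)
  let ?X = "monom 1 1 :: int poly"
  have pp: "(of_nat p :: int poly) = [:int p:]" by (simp add: of_nat_poly)
  have 1: "pCons a h = [:a:] + ?X * h" by (simp add: monom_altdef)
  have 2: "[:int p:] dvd ([:a:] + ?X * h) ^ p - [:a:] ^ p - (?X * h) ^ p"
    using prime_dvd_power_add_diff[OF assms, of "[:a:]" "?X * h"] unfolding pp .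
  \<comment> \<open>\<open>fermat_theorem\<close> concerns naturals not divisible by
    \<open>p\<close>, so \<open>a\<close> is replaced by its natural residue and the divisible case
    is treated separately.\<close>
  have "[a ^ p = a] (mod int p)"
  proof -
    have "[int (nat (a mod int p)) ^ p = int (nat (a mod int p))] (mod int p)"
    proof (cases "p dvd nat (a mod int p)")
      case True
      hence "[nat (a mod int p) ^ p = 0] (mod p)" "[nat (a mod int p) = 0] (mod p)"
        using prime_gt_0_nat[OF assms] dvd_power[of p "nat (a mod int p)"] by (auto simp: cong_0_iff intro: dvd_trans)
      hence "[nat (a mod int p) ^ p = nat (a mod int p)] (mod p)"
        using cong_sym cong_trans by blast
      thus ?thesis unfolding of_nat_power[symmetric] by (simp only: cong_int_iff)
    next
      case False
      hence "[nat (a mod int p) ^ (p - 1) = 1] (mod p)" using assms by (rule fermat_theorem[rotated])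
      hence "[nat (a mod int p) ^ (p - 1) * nat (a mod int p) = 1 * nat (a mod int p)] (mod p)"
        by (rule cong_scalar_right)
      hence "[nat (a mod int p) ^ p = nat (a mod int p)] (mod p)"
        using prime_gt_0_nat[OF assms] power_minus_mult[of p "nat (a mod int p)"] by simp
      thus ?thesis unfolding of_nat_power[symmetric] by (simp only: cong_int_iff)
    qed
    hence "[(a mod int p) ^ p = a mod int p] (mod int p)"
      using prime_gt_0_nat[OF assms] by simp
    thus ?thesis by (simp add: cong_def power_mod)
  qed
  hence "int p dvd a ^ p - a" by (simp add: cong_iff_dvd_diff)
  hence 3: "[:int p:] dvd [:a:] ^ p - [:a:]"
    by (simp add: poly_const_pow)
  have 4: "[:int p:] dvd ?X ^ p * (h ^ p - pcompose h (monom 1 p))"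
    using pCons.IH by (rule dvd_mult)
  have "pcompose (pCons a h) (monom 1 p) = [:a:] + ?X ^ p * pcompose h (monom 1 p)"
    by (simp add: pcompose_pCons monom_power)
  hence "pCons a h ^ p - pcompose (pCons a h) (monom 1 p) =
     (([:a:] + ?X * h) ^ p - [:a:] ^ p - (?X * h) ^ p) + ([:a:] ^ p - [:a:])
      + ?X ^ p * (h ^ p - pcompose h (monom 1 p))"
    unfolding 1 by (simp add: algebra_simps power_mult_distrib)
  thus ?case using 2 3 4 by (simp only: dvd_add)
qed

text \<open>For \<open>M = 0\<close> the equivalence would describe numbers none of whose positive
  powers is 1; \<open>M > 0\<close> leaves the roots of unity of exact order
  \<open>M\<close>.\<close>

definition primitive_root_unity :: "nat \<Rightarrow> complex \<Rightarrow> bool" where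
  "primitive_root_unity M w \<longleftrightarrow> M > 0 \<and> (\<forall>k. w ^ k = 1 \<longleftrightarrow> M dvd k)"

lemma primitive_root_unity_power:
  assumes "primitive_root_unity M w" "coprime j M"
  shows "primitive_root_unity M (w ^ j)"
  unfolding primitive_root_unity_def
proof (intro conjI allI)
  show "M > 0" using assms by (simp add: primitive_root_unity_def)
  fix k
  have "(w ^ j) ^ k = 1 \<longleftrightarrow> M dvd j * k"
    using assms(1) unfolding primitive_root_unity_def power_mult[symmetric] by blast
  also have "\<dots> \<longleftrightarrow> M dvd k"
    using assms(2) by (intro coprime_dvd_mult_right_iff) (simp add: coprime_commute)
  finally show "(w ^ j) ^ k = 1 \<longleftrightarrow> M dvd k" .
qed

text \<open>Write \<open>x\<^sup>M - 1 = f h\<close> with \<open>f\<close> the minimal polynomial of \<open>w\<close>. If \<open>h(w\<^sup>q) = 0\<close>, then \<open>h(w)\<^sup>q\<close> is a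
  multiple of \<open>q\<close> in \<open>\<int>[w]\<close>; since \<open>f'(w) h(w) = M w\<^sup>M\<^sup>-\<^sup>1\<close>, so is \<open>M\<^sup>q\<close>, which forces \<open>q dvd M\<close>.\<close>

lemma root_of_int_poly_power_prime:
  fixes g :: "int poly"
  assumes w: "primitive_root_unity M w" and q: "prime q" "\<not> q dvd M"
    and g: "poly (map_poly of_int g) w = 0"
  shows "poly (map_poly of_int g) (w ^ q) = (0 :: complex)"
proof -
  have inj: "inj_comm_ring_hom (of_int :: int \<Rightarrow> complex)"
    by unfold_locales auto
  interpret map: map_poly_inj_comm_ring_hom "of_int :: int \<Rightarrow> complex"
    by unfold_locales auto
  let ?ev = "\<lambda>g x. poly (map_poly (of_int :: int \<Rightarrow> complex) g) x"
  have M: "M > 0" and wM: "w ^ M = 1" using w by (auto simp: primitive_root_unity_def)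
  define u :: "int poly" where "u = monom 1 M - 1"
  have ev_u: "?ev u x = x ^ M - 1" for x
    by (simp add: u_def hom_distribs poly_monom)
  have u: "u \<noteq> 0" unfolding u_def using M by (auto simp: monom_eq_1_iff)
  obtain f where f: "\<And>q. ?ev q w = 0 \<longleftrightarrow> f dvd q"
    using vanishing_ideal_principal[OF inj u, of w] ev_u wM by auto
  obtain h where h: "u = f * h" using f[of u] ev_u[of w] wM by auto
  have fw: "?ev f w = 0" using f by auto
  have "?ev f (w ^ q) = 0"
  proof (rule ccontr)
    assume nz: "?ev f (w ^ q) \<noteq> 0"
    have "?ev f (w ^ q) * ?ev h (w ^ q) = ?ev u (w ^ q)" by (simp add: h hom_distribs)
    also have "\<dots> = 0" unfolding ev_u using wM by (metis mult.commute power_mult power_one diff_self)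
    finally have hq: "?ev h (w ^ q) = 0" using nz by simp
    obtain e where e: "h ^ q - pcompose h (monom 1 q) = [:int q:] * e"
      using int_poly_power_prime_cong[OF q(1), of h] by (auto elim: dvdE)
    have "?ev (pcompose h (monom 1 q)) w = ?ev h (w ^ q)"
      by (simp add: of_int_hom.map_poly_pcompose poly_pcompose poly_monom)
    hence "?ev (h ^ q) w = ?ev (pcompose h (monom 1 q) + [:int q:] * e) w"
      using e by (metis add.commute diff_add_cancel)
    hence heq: "?ev h w ^ q = of_nat q * ?ev e w"
      using hq \<open>?ev (pcompose h (monom 1 q)) w = ?ev h (w ^ q)\<close> by (simp add: hom_distribs)
    have "pderiv u = f * pderiv h + h * pderiv f" by (simp add: h pderiv_mult)
    moreover have "pderiv u = monom (int M) (M - 1)"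
      by (simp add: u_def pderiv_diff pderiv_monom)
    ultimately have "?ev (monom (int M) (M - 1)) w = ?ev (f * pderiv h + h * pderiv f) w" by simp
    hence "of_nat M * w ^ (M - 1) = ?ev h w * ?ev (pderiv f) w"
      using fw by (simp add: hom_distribs poly_monom)
    hence "of_nat M * (w ^ (M - 1) * w) = ?ev h w * (?ev (pderiv f) w * w)"
      by (simp only: mult.assoc[symmetric])
    hence Mh: "of_nat M = ?ev h w * (?ev (pderiv f) w * w)"
      by (simp only: power_minus_mult[OF M] wM mult_1_right)
    define E where "E = e * (pderiv f * monom 1 1) ^ q"
    have "of_nat M ^ q = (?ev h w * (?ev (pderiv f) w * w)) ^ q" using Mh by simp
    also have "\<dots> = of_nat q * ?ev E w"
      unfolding power_mult_distrib[of "?ev h w"] heq E_def by (simp add: hom_distribs poly_monom)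
    finally have ME: "of_nat M ^ q = of_nat q * ?ev E w" .
    \<comment> \<open>To read off divisibility by \<open>q\<close>, coefficients must be compared.
      As \<open>u\<close> is monic, the leading coefficient of \<open>f\<close> is a unit, so
      \<open>E\<close> can be reduced modulo the monic \<open>f1\<close> to a remainder of degree
      below \<open>degree f\<close>.\<close>
    have "degree u = M" unfolding u_def diff_conv_add_uminus using M
      by (subst degree_add_eq_left) (auto simp: degree_monom_eq)
    hence "monic u" using M by (simp add: u_def)
    hence unit: "lead_coeff f * lead_coeff h = 1" by (simp add: h lead_coeff_mult)
    define f1 where "f1 = smult (lead_coeff h) f"
    have f1: "monic f1" using unit h u by (auto simp: f1_def mult.commute)
    have f1w: "?ev f1 w = 0" using fw by (simp add: f1_def hom_distribs)
    have f_nz: "f \<noteq> 0" using h u by auto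
    have deg: "degree f1 = degree f" unfolding f1_def using unit h u by auto
    obtain Q r where Qr: "pseudo_divmod E f1 = (Q, r)" by (cases "pseudo_divmod E f1")
    have f1_nz: "f1 \<noteq> 0" using f1 by auto
    have r: "E = f1 * Q + r" "r = 0 \<or> degree r < degree f"
      using pseudo_divmod[OF f1_nz Qr] f1 deg by auto
    \<comment> \<open>The relation at \<open>w\<close> now involves a polynomial of smaller degree
      than the minimal polynomial, so it is an identity and its constant coefficient gives the
      divisibility.\<close>
    define d where "d = [:int M ^ q:] - smult (int q) r"
    have "?ev d w = 0" using ME f1w by (simp add: d_def r(1) hom_distribs)
    hence fd: "f dvd d" using f by blast
    have "degree f > 0"
    proof (rule ccontr)
      assume "\<not> degree f > 0"
      then obtain c where "f = [:c:]" using degree_eq_zeroE by auto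
      thus False using fw f_nz by (simp add: hom_distribs)
    qed
    hence "degree d < degree f" using r(2) unfolding d_def
      by (intro degree_diff_less) auto
    hence "d = 0" using fd dvd_imp_degree_le[of f d] by linarith
    hence "coeff d 0 = 0" by simp
    hence "int M ^ q = int q * coeff r 0" by (simp add: d_def)
    hence "int q dvd int M ^ q" by simp
    hence "q dvd M" using q(1) by (metis of_nat_dvd_iff of_nat_power prime_dvd_power)
    thus False using q(2) by simp
  qed
  thus ?thesis using g f[of g] by (auto simp: hom_distribs)
qed

text \<open>Peel the primes off \<open>j\<close> one at a time; each \<open>w ^ p\<close> is again
  primitive of order \<open>M\<close>. This is the irreducibility of cyclotomic polynomials in the
  form needed for conjugation.\<close>

lemma root_of_int_poly_power_coprime:
  fixes g :: "int poly"
  assumes "primitive_root_unity M w" "coprime j M" "poly (map_poly of_int g) w = 0"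
  shows "poly (map_poly of_int g) (w ^ j) = (0 :: complex)"
  using assms
proof (induction j arbitrary: w rule: prime_divisors_induct)
  case zero
  hence "M = 1" by simp
  hence "w = 1" using zero by (auto simp: primitive_root_unity_def dest: spec[of _ 1])
  thus ?case using zero by simp
next
  case (unit j)
  thus ?case by simp
next
  case (factor p j)
  have "coprime p M" "coprime j M" using factor.prems by auto
  have "\<not> p dvd M" using \<open>coprime p M\<close> factor.hyps
    by (metis coprime_absorb_left not_prime_unit)
  have "poly (map_poly of_int g) ((w ^ p) ^ j) = 0"
    using factor.hyps factor.prems \<open>coprime p M\<close> \<open>coprime j M\<close> \<open>\<not> p dvd M\<close>
    by (intro factor.IH primitive_root_unity_power root_of_int_poly_power_prime) auto
  thus ?case by (simp add: power_mult)
qed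


lemma primitive_root_unity_cis:
  assumes "M > 0"
  shows "primitive_root_unity M (cis (2 * pi / real M))"
  unfolding primitive_root_unity_def
proof (intro conjI allI assms)
  fix k
  have "cis (2 * pi / real M) ^ k = 1 \<longleftrightarrow> (\<exists>m :: int. real k / real M = of_int m)"
  proof -
    have "cis (2 * pi / real M) ^ k = 1 \<longleftrightarrow> cos (real k * (2 * pi / real M)) = 1"
      using cos_one_sin_zero[of "real k * (2 * pi / real M)"]
      by (auto simp: DeMoivre complex_eq_iff)
    also have "\<dots> \<longleftrightarrow> (\<exists>m :: int. real k * (2 * pi / real M) = of_int m * 2 * pi)"
      by (rule cos_one_2pi_int)
    also have "\<dots> \<longleftrightarrow> (\<exists>m :: int. real k / real M = of_int m)"
      using assms by (intro ex_cong1) (auto simp: field_simps)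
    finally show ?thesis .
  qed
  also have "\<dots> \<longleftrightarrow> M dvd k"
  proof
    assume "\<exists>m :: int. real k / real M = of_int m"
    then obtain m :: int where "real k = of_int m * real M" using assms by (auto simp: field_simps)
    hence "int k = m * int M" by (metis of_int_eq_iff of_int_mult of_int_of_nat_eq)
    thus "M dvd k" by (metis dvd_triv_right of_nat_dvd_iff)
  next
    assume "M dvd k"
    then obtain m where "k = M * m" ..
    hence "real k / real M = of_int (int m)" using assms by simp
    thus "\<exists>m :: int. real k / real M = of_int m" ..
  qed
  finally show "cis (2 * pi / real M) ^ k = 1 \<longleftrightarrow> M dvd k" .
qed

text \<open>The first \<open>M\<close> powers of \<open>w\<close> are distinct, and
  \<open>z ^ M = 1\<close> has at most \<open>M\<close> solutions.\<close>

lemma primitive_root_unity_generates: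
  assumes w: "primitive_root_unity M w" and x: "x ^ M = 1"
  obtains e where "x = w ^ e"
proof -
  have M: "M > 0" and w1: "w ^ M = 1" using w by (auto simp: primitive_root_unity_def)
  have w0: "w \<noteq> 0" using w1 M by (auto simp: power_0_left)
  have inj: "inj_on (\<lambda>e. w ^ e) {..<M}"
  proof (rule linorder_inj_onI)
    fix a b assume ab: "a < b" "a \<in> {..<M}" "b \<in> {..<M}"
    show "w ^ a \<noteq> w ^ b"
    proof
      assume "w ^ a = w ^ b"
      also have "w ^ b = w ^ a * w ^ (b - a)" using ab by (simp flip: power_add)
      finally have "w ^ (b - a) = 1" using w0 by simp
      hence "M dvd b - a" using w by (simp add: primitive_root_unity_def)
      thus False using ab by (auto dest: dvd_imp_le)
    qed
  qed auto
  have fin: "finite {z :: complex. z ^ M = 1}" and card: "card {z :: complex. z ^ M = 1} \<le> M"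
    using M by (auto simp: finite_nth_roots card_nth_roots)
  have "(\<lambda>e. w ^ e) ` {..<M} = {z. z ^ M = 1}"
  proof (rule card_seteq[OF fin])
    show "(\<lambda>e. w ^ e) ` {..<M} \<subseteq> {z. z ^ M = 1}"
      using w1 by (auto simp flip: power_mult) (metis mult.commute power_mult power_one)
    show "card {z :: complex. z ^ M = 1} \<le> card ((\<lambda>e. w ^ e) ` {..<M})"
      using card card_image[OF inj] by simp
  qed
  thus ?thesis using x that by auto
qed

text \<open>This replaces the descent of the curve to a number field: the complex coefficients are expanded
  in a basis over the cyclotomic numbers, without choosing one explicitly. The induction removes a
  coefficient that depends linearly on the others.\<close>

lemma linear_relation_conjugate:
  fixes c :: "'i \<Rightarrow> complex"
  assumes "finite I"
  shows "\<exists>N>0. \<forall>M w j (g :: 'i \<Rightarrow> int poly). N dvd M \<longrightarrow> primitive_root_unity M w \<longrightarrow>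
           coprime j M \<longrightarrow> [j = 1] (mod N) \<longrightarrow>
           (\<Sum>i\<in>I. c i * poly (map_poly of_int (g i)) w) = 0 \<longrightarrow>
           (\<Sum>i\<in>I. c i * poly (map_poly of_int (g i)) (w ^ j)) = 0"
  using assms
proof (induction I rule: finite_psubset_induct)
  case (psubset I)
  let ?ev = "\<lambda>g x. poly (map_poly (of_int :: int \<Rightarrow> complex) g) x"
  interpret map: map_poly_inj_comm_ring_hom "of_int :: int \<Rightarrow> complex"
    by unfold_locales auto
  \<comment> \<open>The dichotomy is whether the \<open>c i\<close> are linearly independent over
    the cyclotomic numbers. If they are, every coefficient of a relation vanishes separately, and
    each can be conjugated on its own.\<close>
  show ?case
  proof (cases "\<exists>N0 w0 (d :: 'i \<Rightarrow> int poly). primitive_root_unity N0 w0 \<and>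
      (\<Sum>i\<in>I. c i * ?ev (d i) w0) = 0 \<and> (\<exists>i\<in>I. ?ev (d i) w0 \<noteq> 0)")
    case False
    hence *: "\<forall>i\<in>I. ?ev (g i) w = 0"
      if "primitive_root_unity M w" "(\<Sum>i\<in>I. c i * ?ev (g i) w) = 0" for M w and g :: "'i \<Rightarrow> int poly"
      using that by blast
    have "(\<Sum>i\<in>I. c i * ?ev (g i) (w ^ j)) = 0"
      if "primitive_root_unity M w" "coprime j M" "(\<Sum>i\<in>I. c i * ?ev (g i) w) = 0"
      for M w j and g :: "'i \<Rightarrow> int poly"
      using *[OF that(1,3)] root_of_int_poly_power_coprime[OF that(1,2)]
      by (intro sum.neutral) auto
    thus ?thesis by (intro exI[of _ 1]) auto
  next
    case True
    then obtain N0 w0 d i0 where N0: "primitive_root_unity N0 w0"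
      and rel: "(\<Sum>i\<in>I. c i * ?ev (d i) w0) = 0" and i0: "i0 \<in> I" "?ev (d i0) w0 \<noteq> 0"
      by blast
    have "I - {i0} \<subset> I" using i0 by auto
    from psubset.IH[OF this] obtain N1 where N1: "N1 > 0"
      and IH: "\<And>M w j (g :: 'i \<Rightarrow> int poly). N1 dvd M \<Longrightarrow> primitive_root_unity M w \<Longrightarrow>
           coprime j M \<Longrightarrow> [j = 1] (mod N1) \<Longrightarrow> (\<Sum>i\<in>I - {i0}. c i * ?ev (g i) w) = 0 \<Longrightarrow>
           (\<Sum>i\<in>I - {i0}. c i * ?ev (g i) (w ^ j)) = 0" by blast
    have N0_pos: "N0 > 0" and w0: "w0 ^ N0 = 1" using N0 by (auto simp: primitive_root_unity_def)
    \<comment> \<open>The factor \<open>N0\<close> of the modulus makes the passage from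
      \<open>w\<close> to \<open>w ^ j\<close> fix \<open>w0\<close>, which preserves the chosen
      relation; \<open>N1\<close> serves the induction hypothesis.\<close>
    have "(\<Sum>i\<in>I. c i * ?ev (g i) (w ^ j)) = 0"
      if M: "N0 * N1 dvd M" and w: "primitive_root_unity M w" and j: "coprime j M"
        and cong: "[j = 1] (mod (N0 * N1))" and zero: "(\<Sum>i\<in>I. c i * ?ev (g i) w) = 0"
      for M w j and g :: "'i \<Rightarrow> int poly"
    proof -
      have "N0 dvd M" "N1 dvd M" using M dvd_mult_left dvd_mult_right by blast+
      have "w0 ^ M = 1" using w0 \<open>N0 dvd M\<close> by (auto simp: power_mult)
      then obtain e where e: "w0 = w ^ e" using primitive_root_unity_generates[OF w] by metis
      have "[j = 1] (mod N0)" "[j = 1] (mod N1)"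
        using cong cong_dvd_modulus_nat[of j 1 "N0 * N1"] by auto
      \<comment> \<open>\<open>j = 0\<close> is separate because \<open>j - 1\<close> truncates;
        there the congruence forces \<open>N0 = 1\<close>.\<close>
      have w0j: "w0 ^ j = w0"
      proof (cases "j = 0")
        case True
        hence "N0 = 1" using \<open>[j = 1] (mod N0)\<close> by (simp add: cong_0_1_nat')
        thus ?thesis using w0 True by simp
      next
        case False
        hence "N0 dvd j - 1" using \<open>[j = 1] (mod N0)\<close> by (simp add: cong_altdef_nat)
        then obtain l where "j - 1 = N0 * l" ..
        hence "j = N0 * l + 1" using False by simp
        thus ?thesis using w0 by (simp add: power_mult)
      qed
      \<comment> \<open>As \<open>w0\<close> is a power of \<open>w\<close>, substituting
        \<open>x ^ e\<close> moves the fixed relation to \<open>w\<close>, with the same values at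
        \<open>w\<close> and \<open>w ^ j\<close>.\<close>
      define d' where "d' = (\<lambda>i. pcompose (d i) (monom 1 e))"
      have ev_d': "?ev (d' i) w = ?ev (d i) w0" "?ev (d' i) (w ^ j) = ?ev (d i) w0" for i
      proof -
        have *: "?ev (d' i) x = ?ev (d i) (x ^ e)" for x
          by (simp add: d'_def of_int_hom.map_poly_pcompose poly_pcompose poly_monom)
        show "?ev (d' i) w = ?ev (d i) w0" by (simp add: * e)
        show "?ev (d' i) (w ^ j) = ?ev (d i) w0"
          using w0j unfolding * e by (metis mult.commute power_mult)
      qed
      \<comment> \<open>Cross-multiplication cancels the coefficient of \<open>c i0\<close> without
        division; afterwards the nonzero value of \<open>d i0\<close> at \<open>w0\<close> gives
        back the original relation.\<close>
      define g' where "g' = (\<lambda>i. g i * d' i0 - g i0 * d' i)"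
      have split: "(\<Sum>i\<in>I - {i0}. c i * ?ev (g' i) x) =
          ?ev (d' i0) x * (\<Sum>i\<in>I. c i * ?ev (g i) x) - ?ev (g i0) x * (\<Sum>i\<in>I. c i * ?ev (d' i) x)"
        for x
      proof -
        have "(\<Sum>i\<in>I - {i0}. c i * ?ev (g' i) x) = (\<Sum>i\<in>I. c i * ?ev (g' i) x)"
          using psubset.hyps i0 by (simp add: sum.remove[of I i0] g'_def mult.commute)
        also have "\<dots> = (\<Sum>i\<in>I. ?ev (d' i0) x * (c i * ?ev (g i) x) - ?ev (g i0) x * (c i * ?ev (d' i) x))"
          by (intro sum.cong) (simp_all add: g'_def hom_distribs algebra_simps)
        finally show ?thesis by (simp add: sum_subtractf sum_distrib_left)
      qed
      have "(\<Sum>i\<in>I - {i0}. c i * ?ev (g' i) w) = 0"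
        unfolding split using zero rel by (simp add: ev_d')
      from IH[OF \<open>N1 dvd M\<close> w j \<open>[j = 1] (mod N1)\<close> this]
      show ?thesis unfolding split using rel i0(2) by (simp add: ev_d')
    qed
    thus ?thesis using N0_pos N1 by (intro exI[of _ "N0 * N1"]) auto
  qed
qed

section \<open>A lower bound for Euler's totient\<close>

lemma cube_le_totient_power_4:
  assumes "n > 0"
  shows "n ^ 3 \<le> 16 * totient n ^ 4"
proof -
  \<comment> \<open>By multiplicativity it suffices to treat prime powers. There
    \<open>p ^ 3 \<le> (p - 1) ^ 4\<close> fails only for 2 and 3, and the factors 8 and 2 repair
    it; their product is the constant 16.\<close>
  define W :: "nat \<Rightarrow> nat" where "W = (\<lambda>n. (if 2 dvd n then 8 else 1) * (if 3 dvd n then 2 else 1))"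
  have pow: "(p ^ k) ^ 3 \<le> W p * totient (p ^ k) ^ 4" if p: "prime p" and k: "k > 0" for p k :: nat
  proof -
    have "p ^ 3 \<le> W p * (p - 1) ^ 4"
    proof -
      have "p \<ge> 2" using p prime_ge_2_nat by blast
      then consider "p = 2" | "p = 3" | "p = 4" | "p \<ge> 5" by linarith
      thus ?thesis
      proof cases
        case 4
        \<comment> \<open>\<open>m \<ge> 4\<close> yields \<open>4 * p \<le> 5 * m\<close>, and
          \<open>125 \<le> 256 = 64 * 4\<close>.\<close>
        define m where "m = p - 1"
        have m: "p = m + 1" "m \<ge> 4" using 4 by (auto simp: m_def)
        have "64 * p ^ 3 = (4 * p) ^ 3" by (simp add: power_mult_distrib)
        also have "\<dots> \<le> (5 * m) ^ 3" using m by (intro power_mono) auto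
        also have "\<dots> \<le> 256 * m ^ 3" by (simp add: power_mult_distrib)
        also have "\<dots> \<le> 64 * m ^ 4" using m(2) by (simp add: power_Suc[of m 3, simplified])
        finally have "p ^ 3 \<le> (p - 1) ^ 4" by (simp add: m)
        also have "\<dots> \<le> W p * (p - 1) ^ 4" by (simp add: W_def)
        finally show ?thesis .
      qed (auto simp: W_def)
    qed
    moreover have "p ^ (3 * (k - 1)) \<le> p ^ (4 * (k - 1))"
      using prime_gt_0_nat[OF p] by (intro power_increasing) auto
    ultimately have "p ^ (3 * (k - 1)) * p ^ 3 \<le> p ^ (4 * (k - 1)) * (W p * (p - 1) ^ 4)"
      by (rule mult_le_mono[rotated])
    moreover have "(p ^ k) ^ 3 = p ^ (3 * (k - 1)) * p ^ 3"
      using k by (simp flip: power_mult power_add add: algebra_simps)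
    moreover have "totient (p ^ k) ^ 4 = p ^ (4 * (k - 1)) * (p - 1) ^ 4"
      using k p by (simp add: totient_prime_power power_mult_distrib mult.commute flip: power_mult)
    ultimately show ?thesis by (simp add: algebra_simps)
  qed
  have "n ^ 3 \<le> W n * totient n ^ 4" using assms
  proof (induction n rule: less_induct)
    case (less n)
    show ?case
    proof (cases "n = 1")
      case True
      thus ?thesis by (simp add: W_def)
    next
      case False
      then obtain p where p: "prime p" "p dvd n" using prime_factor_nat by blast
      define k where "k = multiplicity p n"
      obtain m where m: "n = p ^ k * m" "\<not> p dvd m"
        using multiplicity_decompose'[of n p] less.prems p unfolding k_def
        by (metis neq0_conv not_prime_unit)
      have k: "k > 0" using m p by (metis mult_1 neq0_conv power_0)
      have m0: "m > 0" using m less.prems by (metis mult_0_right neq0_conv)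
      have "1 < p ^ k" using p k by (metis one_less_power prime_gt_1_nat)
      hence "m < n" using m m0 by simp
      have cop: "coprime (p ^ k) m" using p m(2) by (simp add: prime_imp_coprime)
      \<comment> \<open>As \<open>p\<close> does not divide \<open>m\<close>, the primes 2 and 3 are
        each charged to at most one of the two factors.\<close>
      have "p = q" if "q dvd p" "prime q" for q using that p(1) primes_dvd_imp_eq by blast
      from this[of 2] this[of 3] have W: "W p * W m \<le> W n"
        using m(1) m(2) p(1) k unfolding W_def
        by (auto simp: prime_dvd_mult_iff prime_dvd_power_iff)
      have "n ^ 3 = (p ^ k) ^ 3 * m ^ 3" using m by (simp add: power_mult_distrib)
      also have "\<dots> \<le> (W p * totient (p ^ k) ^ 4) * (W m * totient m ^ 4)"
        using pow[OF p(1) k] less.IH[OF \<open>m < n\<close> m0] by (rule mult_le_mono)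
      also have "\<dots> = W p * W m * totient n ^ 4"
        using m(1) by (simp add: totient_mult_coprime[OF cop] power_mult_distrib)
      also have "\<dots> \<le> W n * totient n ^ 4" using W by simp
      finally show ?thesis .
    qed
  qed
  also have "\<dots> \<le> 16 * totient n ^ 4" by (simp add: W_def)
  finally show ?thesis .
qed

section \<open>Torsion points on plane curves\<close>

lemma degree_det_le_sum:
  fixes A :: "'a :: comm_ring_1 poly mat"
  assumes A: "A \<in> carrier_mat n n"
    and deg: "\<And>i j. i < n \<Longrightarrow> j < n \<Longrightarrow> degree (A $$ (i,j)) \<le> b i"
  shows "degree (det A) \<le> (\<Sum>i<n. b i)"
proof -
  \<comment> \<open>Each Leibniz summand takes exactly one entry from every row, so the row bounds
    add up.\<close>
  have "degree (signof p * (\<Prod>i = 0..<n. A $$ (i, p i))) \<le> (\<Sum>i<n. b i)"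
    if p: "p permutes {0..<n}" for p
  proof -
    have "degree (signof p * (\<Prod>i = 0..<n. A $$ (i, p i)))
        \<le> degree (signof p :: 'a poly) + degree (\<Prod>i = 0..<n. A $$ (i, p i))"
      by (rule degree_mult_le)
    also have "degree (signof p :: 'a poly) = 0" by (simp add: sign_def)
    also have "0 + degree (\<Prod>i = 0..<n. A $$ (i, p i)) \<le> (\<Sum>i = 0..<n. degree (A $$ (i, p i)))"
      using degree_prod_sum_le[of "{0..<n}" "\<lambda>i. A $$ (i, p i)"] by (simp add: o_def)
    also have "\<dots> \<le> (\<Sum>i = 0..<n. b i)"
      using p by (intro sum_mono deg) auto
    finally show ?thesis by (simp add: atLeast0LessThan)
  qed
  thus ?thesis unfolding det_def'[OF A] by (intro degree_sum_le) (auto simp: finite_permutations)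
qed

text \<open>\<open>h\<close> may kill the leading coefficient; summing up to the original degree
  then only adds zero terms and keeps the index range independent of the specialization.\<close>

lemma poly_map_poly_altdef:
  fixes h :: "'a :: zero \<Rightarrow> 'b :: comm_semiring_1"
  assumes "h 0 = 0"
  shows "poly (map_poly h H) y = (\<Sum>k\<le>degree H. h (coeff H k) * y ^ k)"
proof -
  have "poly (map_poly h H) y = (\<Sum>k\<le>degree (map_poly h H). coeff (map_poly h H) k * y ^ k)"
    by (rule poly_altdef)
  also have "\<dots> = (\<Sum>k\<le>degree H. coeff (map_poly h H) k * y ^ k)"
    using degree_map_poly_le[of h H] by (intro sum.mono_neutral_left) (auto simp: not_le coeff_eq_0)
  finally show ?thesis by (simp add: coeff_map_poly assms)
qed

abbreviation poly2 :: "complex poly poly \<Rightarrow> complex \<Rightarrow> complex \<Rightarrow> complex" where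
  "poly2 F x y \<equiv> poly (map_poly (\<lambda>c. poly c x) F) y"

text \<open>A vector of powers of \<open>y\<close> lies in the kernel of the specialized Sylvester
  matrix. Specializing the matrix instead of the two polynomials keeps its size even if leading
  coefficients vanish at \<open>x\<close>.\<close>

lemma resultant_common_root:
  assumes "poly2 F x y = 0" "poly2 G x y = 0" "degree F + degree G > 0"
  shows "poly (resultant F G) x = 0"
proof -
  let ?m = "degree F" and ?n = "degree G"
  let ?h = "\<lambda>c :: complex poly. poly c x"
  have hom: "comm_ring_hom ?h" by unfold_locales auto
  define S where "S = map_mat ?h (sylvester_mat F G)"
  have S: "S \<in> carrier_mat (?m + ?n) (?m + ?n)" by (simp add: S_def sylvester_carrier_mat)
  \<comment> \<open>The powers descend because Sylvester rows start with the leading coefficient.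
    The last entry is \<open>y ^ 0\<close>, so \<open>v\<close> is nonzero even for
    \<open>y = 0\<close>.\<close>
  define v where "v = vec (?m + ?n) (\<lambda>j. y ^ (?m + ?n - 1 - j))"
  have v: "v \<in> carrier_vec (?m + ?n)" by (simp add: v_def)
  have "v $ (?m + ?n - 1) = 1" using assms(3) by (simp add: v_def)
  hence v0: "v \<noteq> 0\<^sub>v (?m + ?n)" using assms(3) by auto
  have expand: "(\<Sum>k\<le>degree H. ?h (coeff H k) * y ^ (k + d)) = y ^ d * poly2 H x y"
    for H :: "complex poly poly" and d
  proof -
    have "poly2 H x y = (\<Sum>k\<le>degree H. ?h (coeff H k) * y ^ k)"
      by (rule poly_map_poly_altdef) simp
    thus ?thesis by (simp add: sum_distrib_left power_add algebra_simps)
  qed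
  have "S *\<^sub>v v = 0\<^sub>v (?m + ?n)"
  proof (rule eq_vecI)
    fix i assume "i < dim_vec (0\<^sub>v (?m + ?n))"
    hence i: "i < ?m + ?n" by simp
    have *: "(S *\<^sub>v v) $ i = (\<Sum>j<?m + ?n. ?h (sylvester_mat F G $$ (i, j)) * y ^ (?m + ?n - 1 - j))"
      using i S by (simp add: v_def S_def scalar_prod_def atLeast0LessThan)
    \<comment> \<open>Both blocks consist of rows carrying the coefficients of some \<open>H\<close>
      shifted by \<open>l\<close>; the product with \<open>v\<close> is \<open>poly2 H x y\<close>
      times a power of \<open>y\<close>.\<close>
    have row: "(\<Sum>j<?m + ?n. ?h (if l \<le> j \<and> j - l \<le> degree H then coeff H (degree H + l - j) else 0)
        * y ^ (?m + ?n - 1 - j)) = 0"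
      if H: "poly2 H x y = 0" and l: "l + degree H < ?m + ?n" for H :: "complex poly poly" and l
    proof -
      have "(\<Sum>j<?m + ?n. ?h (if l \<le> j \<and> j - l \<le> degree H then coeff H (degree H + l - j) else 0)
        * y ^ (?m + ?n - 1 - j)) =
        (\<Sum>j\<in>{l..l + degree H}. ?h (coeff H (degree H + l - j)) * y ^ (?m + ?n - 1 - j))"
        using l by (intro sum.mono_neutral_cong_right) auto
      also have "\<dots> = (\<Sum>k\<le>degree H. ?h (coeff H k) * y ^ (k + (?m + ?n - 1 - l - degree H)))"
        using l by (intro sum.reindex_bij_witness[of _ "\<lambda>k. degree H + l - k" "\<lambda>j. degree H + l - j"])
          auto
      also have "\<dots> = 0" unfolding expand H by simp
      finally show ?thesis .
    qed
    have "(S *\<^sub>v v) $ i = 0"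
    proof (cases "i < ?n")
      case True
      hence "(S *\<^sub>v v) $ i = (\<Sum>j<?m + ?n. ?h (if i \<le> j \<and> j - i \<le> ?m then coeff F (?m + i - j) else 0)
        * y ^ (?m + ?n - 1 - j))"
        unfolding * using i by (intro sum.cong) (auto simp: sylvester_index_mat)
      also have "\<dots> = 0" using True assms(1) by (intro row) auto
      finally show ?thesis .
    next
      case False
      hence "(S *\<^sub>v v) $ i = (\<Sum>j<?m + ?n. ?h (if i - ?n \<le> j \<and> j - (i - ?n) \<le> ?n then
          coeff G (?n + (i - ?n) - j) else 0) * y ^ (?m + ?n - 1 - j))"
        unfolding * using i by (intro sum.cong) (auto simp: sylvester_index_mat)
      also have "\<dots> = 0" using False i assms(2) by (intro row) auto
      finally show ?thesis .
    qed
    thus "(S *\<^sub>v v) $ i = 0\<^sub>v (?m + ?n) $ i" using i by simp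
  qed (use S in auto)
  hence "det S = 0" using det_0_iff_vec_prod_zero_field[OF S] v v0 by blast
  thus ?thesis by (simp only: S_def comm_ring_hom.hom_det[OF hom] resultant_def)
qed

text \<open>Irreducibility leaves no common factor of positive degree, so the resultant is a nonzero
  polynomial in \<open>x\<close> of degree at most \<open>(a + d) * b\<close>. Above each of its
  roots lie at most \<open>d\<close> points of the curve, since \<open>nz\<close> excludes vertical
  lines.\<close>

lemma card_common_zeros_le:
  fixes F G :: "complex poly poly"
  assumes irr: "irreducible F" and ndvd: "\<not> F dvd G" and d: "degree F = d" "d > 0"
    and nz: "\<And>x. map_poly (\<lambda>c. poly c x) F \<noteq> 0"
    and a: "\<And>i. degree (coeff F i) \<le> a" and b: "\<And>i. degree (coeff G i) \<le> b" "degree G \<le> b"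
    and P: "finite P" "\<And>x y. (x, y) \<in> P \<Longrightarrow> poly2 F x y = 0 \<and> poly2 G x y = 0"
  shows "card P \<le> (a + d) * d * b"
proof -
  define R where "R = resultant F G"
  have "degree (gcd F G) = 0"
  proof -
    have "is_unit (gcd F G) \<or> F dvd gcd F G"
      using irr unfolding irreducible_altdef by (meson gcd_dvd1)
    hence "is_unit (gcd F G)" using ndvd dvd_trans gcd_dvd2 by blast
    thus ?thesis by (auto simp: is_unit_poly_iff)
  qed
  hence R: "R \<noteq> 0" unfolding R_def using resultant_0_gcd[of F G] by simp
  have degR: "degree R \<le> (a + d) * b"
  proof -
    \<comment> \<open>The first \<open>degree G\<close> rows carry coefficients of \<open>F\<close>,
      the remaining \<open>d\<close> rows coefficients of \<open>G\<close>.\<close>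
    have "degree R \<le> (\<Sum>i<degree F + degree G. if i < degree G then a else b)"
      unfolding R_def resultant_def
      by (rule degree_det_le_sum[OF sylvester_carrier_mat]) (auto simp: sylvester_index_mat a b)
    also have "\<dots> = (\<Sum>i\<in>{..<degree G}. a) + (\<Sum>i\<in>{degree G..<degree G + d}. b)"
    proof -
      have "{..<degree F + degree G} = {..<degree G} \<union> {degree G..<degree G + d}" using d by auto
      thus ?thesis by (simp add: sum.union_disjoint ivl_disj_int)
    qed
    also have "\<dots> = degree G * a + d * b" by simp
    also have "\<dots> \<le> b * a + d * b" using b(2) by simp
    finally show ?thesis by (simp add: algebra_simps)
  qed
  have "P \<subseteq> (SIGMA x:{x. poly R x = 0}. {y. poly2 F x y = 0})"
    using P(2) resultant_common_root[where F = F and G = G] d unfolding R_def by auto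
  hence "card P \<le> card (SIGMA x:{x. poly R x = 0}. {y. poly2 F x y = 0})"
    using nz R by (intro card_mono finite_SigmaI poly_roots_finite) auto
  also have "\<dots> = (\<Sum>x\<in>{x. poly R x = 0}. card {y. poly2 F x y = 0})"
    using nz R by (intro card_SigmaI ballI poly_roots_finite) auto
  also have "\<dots> \<le> (\<Sum>x\<in>{x. poly R x = 0}. d)"
  proof (rule sum_mono)
    fix x
    have "card {y. poly2 F x y = 0} \<le> degree (map_poly (\<lambda>c. poly c x) F)"
      using nz by (rule card_poly_roots_bound)
    also have "\<dots> \<le> d" using degree_map_poly_le[of "\<lambda>c. poly c x" F] d by simp
    finally show "card {y. poly2 F x y = 0} \<le> d" .
  qed
  also have "\<dots> \<le> degree R * d"
    using card_poly_roots_bound[OF R] by simp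
  also have "\<dots> \<le> (a + d) * b * d" using degR by simp
  finally show ?thesis by (simp add: algebra_simps)
qed

section \<open>Counting the conjugates of a torsion point\<close>

lemma totient_le_mult_card_cong_1:
  assumes N: "N > 0" "N dvd M" and M: "M > 0"
  shows "totient M \<le> N * card {j\<in>{..<M}. coprime j M \<and> [j = 1] (mod N)}"
    (is "_ \<le> N * card ?J")
proof -
  \<comment> \<open>Pigeonhole over the residue classes modulo \<open>N\<close>: multiplying by the
    inverse modulo \<open>M\<close> of one member \<open>j0\<close> maps its class injectively into
    the class of 1.\<close>
  let ?T = "\<lambda>r. {k\<in>totatives M. k mod N = r}"
  have "card (?T r) \<le> card ?J" for r
  proof (cases "?T r = {}")
    case False
    then obtain j0 where j0: "j0 \<in> totatives M" "j0 mod N = r" by auto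
    hence cop: "coprime j0 M" by (simp add: totatives_def)
    then obtain i0 where i0: "[j0 * i0 = 1] (mod M)" using cong_solve_coprime_nat[OF cop] by auto
    have cop_i0: "coprime i0 M"
      using cong_imp_coprime[OF cong_sym[OF i0]] by simp
    show ?thesis
    proof (rule card_inj_on_le)
      show "inj_on (\<lambda>k. k * i0 mod M) (?T r)"
      proof (rule linorder_inj_onI)
        fix k l assume kl: "k < l" "k \<in> ?T r" "l \<in> ?T r"
        show "k * i0 mod M \<noteq> l * i0 mod M"
        proof
          assume "k * i0 mod M = l * i0 mod M"
          hence "[k = l] (mod M)" using cong_mult_rcancel_nat[OF cop_i0] by (simp add: cong_def)
          hence "M dvd l - k" using kl(1) by (metis cong_altdef_nat cong_sym less_imp_le)
          hence "M \<le> l - k" using kl(1) by (auto dest: dvd_imp_le)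
          moreover have "l \<le> M" "k > 0" using kl by (auto simp: totatives_def)
          ultimately show False using kl(1) by linarith
        qed
      qed auto
      show "(\<lambda>k. k * i0 mod M) ` ?T r \<subseteq> ?J"
      proof safe
        fix k assume k: "k \<in> totatives M" "r = k mod N"
        show "k * i0 mod M < M" using M by simp
        have "coprime (k * i0) M" using k cop_i0 by (simp add: totatives_def)
        thus "coprime (k * i0 mod M) M" using M by simp
        have "[k * i0 = j0 * i0] (mod N)" using k j0 by (intro cong_mult) (simp_all add: cong_def)
        also have "[j0 * i0 = 1] (mod N)" using i0 N(2) by (rule cong_dvd_modulus_nat)
        finally have "[k * i0 = 1] (mod N)" .
        thus "[k * i0 mod M = 1] (mod N)" using N(2) by (simp add: cong_def mod_mod_cancel)
      qed
    qed auto
  next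
    case True
    show ?thesis unfolding True by simp
  qed
  moreover have "totient M = card (\<Union>r<N. ?T r)"
    unfolding totient_def using N by (intro arg_cong[of _ _ card]) auto
  ultimately have "totient M \<le> (\<Sum>r<N. card ?J)"
    by (metis (no_types, lifting) card_UN_le finite_lessThan order.trans sum_mono)
  thus ?thesis by simp
qed

text \<open>\<open>ndvd\<close> excludes components of curves
  \<open>x ^ i * y ^ j = x ^ k * y ^ l\<close>, which can carry infinitely many torsion points, and
  \<open>nz\<close> excludes vertical lines. The proof bounds the order of a torsion point on the
  curve by a constant \<open>B\<close>.\<close>

lemma finite_torsion_points:
  fixes F :: "complex poly poly"
  assumes irr: "irreducible F" and d: "degree F > 0"
    and nz: "\<And>x. map_poly (\<lambda>c. poly c x) F \<noteq> 0"
    and ndvd: "\<And>i j k l. (i, j) \<noteq> (k, l) \<Longrightarrow>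
      \<not> F dvd monom (monom 1 i) j - monom (monom 1 k) l"
  shows "finite {(x, y). poly2 F x y = 0 \<and> (\<exists>k>0. x ^ k = 1 \<and> y ^ k = 1)}"
proof -
  define d where "d = degree F"
  define a where "a = Max ((\<lambda>i. degree (coeff F i)) ` {..d})"
  have a: "degree (coeff F i) \<le> a" for i
  proof (cases "i \<le> d")
    case True
    thus ?thesis unfolding a_def by (intro Max_ge) auto
  next
    case False
    thus ?thesis by (simp add: d_def coeff_eq_0)
  qed
  define I where "I = {..d} \<times> {..a}"
  define c where "c = (\<lambda>(i, j). coeff (coeff F i) j)"
  have poly2_F: "poly2 F x y = (\<Sum>(i, j)\<in>I. c (i, j) * (x ^ j * y ^ i))" for x y
  proof -
    have "poly2 F x y = (\<Sum>i\<le>d. poly (coeff F i) x * y ^ i)"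
      unfolding d_def by (rule poly_map_poly_altdef) simp
    also have "\<dots> = (\<Sum>i\<le>d. \<Sum>j\<le>a. c (i, j) * (x ^ j * y ^ i))"
    proof (rule sum.cong[OF refl])
      fix i
      have "poly (coeff F i) x = (\<Sum>j\<le>a. coeff (coeff F i) j * x ^ j)"
        unfolding poly_altdef using a[of i]
        by (intro sum.mono_neutral_left) (auto simp: coeff_eq_0)
      thus "poly (coeff F i) x * y ^ i = (\<Sum>j\<le>a. c (i, j) * (x ^ j * y ^ i))"
        by (simp add: c_def sum_distrib_right mult.assoc)
    qed
    finally show ?thesis by (simp add: I_def sum.cartesian_product)
  qed
  have "finite I" by (simp add: I_def)
  from linear_relation_conjugate[OF this, of c] obtain N where N: "N > 0"
    and conj: "\<And>M w j (g :: nat \<times> nat \<Rightarrow> int poly). N dvd M \<Longrightarrow> primitive_root_unity M w \<Longrightarrow>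
           coprime j M \<Longrightarrow> [j = 1] (mod N) \<Longrightarrow>
           (\<Sum>i\<in>I. c i * poly (map_poly of_int (g i)) w) = 0 \<Longrightarrow>
           (\<Sum>i\<in>I. c i * poly (map_poly of_int (g i)) (w ^ j)) = 0" by blast
  \<comment> \<open>\<open>C\<close> collects the factors in \<open>totient M \<le> C * s\<close>,
    where \<open>s\<close> is the integer square root of the order. \<open>B\<close> is what remains
    of \<open>M ^ 3 \<le> 16 * totient M ^ 4\<close> after \<open>s ^ 4 \<le> M ^ 2\<close>.\<close>
  define C where "C = N ^ 2 * ((a + d) * d)"
  define B where "B = 16 * C ^ 4"
  have bound: "\<exists>n>0. n \<le> B \<and> x ^ n = 1 \<and> y ^ n = 1"
    if xy: "poly2 F x y = 0" and k: "k > 0" "x ^ k = 1" "y ^ k = 1" for x y :: complex and k :: nat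
  proof -
    define n where "n = (LEAST n. n > 0 \<and> x ^ n = 1 \<and> y ^ n = 1)"
    have n: "n > 0" "x ^ n = 1" "y ^ n = 1"
      using LeastI[of "\<lambda>n. n > 0 \<and> x ^ n = 1 \<and> y ^ n = 1" k] k unfolding n_def by auto
    have least: "n \<le> m" if "m > 0" "x ^ m = 1" "y ^ m = 1" for m
      unfolding n_def using that by (intro Least_le) auto
    have x0: "x \<noteq> 0" and y0: "y \<noteq> 0" using n by (auto simp: power_0_left)
    have order: "n dvd j - i" if "x ^ i = x ^ j" "y ^ i = y ^ j" "i \<le> j" for i j
    proof -
      have "z ^ (j - i) = 1" if "z ^ i = z ^ j" "z \<noteq> 0" for z :: complex
      proof -
        have "z ^ j = z ^ i * z ^ (j - i)" using \<open>i \<le> j\<close> by (simp flip: power_add)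
        thus ?thesis using that by simp
      qed
      hence one: "x ^ (j - i) = 1" "y ^ (j - i) = 1" using that x0 y0 by blast+
      have "z ^ ((j - i) mod n) = 1" if "z ^ (j - i) = 1" "z ^ n = 1" for z :: complex
      proof -
        have "z ^ (j - i) = (z ^ n) ^ ((j - i) div n) * z ^ ((j - i) mod n)"
          by (simp flip: power_mult power_add)
        thus ?thesis using that by simp
      qed
      from this[OF one(1) n(2)] this[OF one(2) n(3)] least[of "(j - i) mod n"] n(1)
      show ?thesis by (metis mod_greater_zero_iff_not_dvd mod_less_divisor not_le)
    qed
    define s where "s = nat \<lfloor>sqrt (real n)\<rfloor>"
    have s: "s\<^sup>2 \<le> n" "n < (s + 1)\<^sup>2"
    proof -
      have "real s \<le> sqrt (real n)" "sqrt (real n) < real s + 1"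
        unfolding s_def by (auto simp: of_nat_nat)
      hence "real s ^ 2 \<le> sqrt (real n) ^ 2" "sqrt (real n) ^ 2 < (real s + 1) ^ 2"
        by (auto intro!: power_mono power_strict_mono simp del: real_sqrt_pow2_iff real_sqrt_pow2)
      hence "real (s\<^sup>2) \<le> real n" "real n < real ((s + 1)\<^sup>2)" by (simp_all add: add.commute)
      thus "s\<^sup>2 \<le> n" "n < (s + 1)\<^sup>2" by (simp_all only: of_nat_le_iff of_nat_less_iff)
    qed
    \<comment> \<open>More than \<open>n\<close> exponent pairs compete for at most \<open>n\<close>
      values \<open>z\<close> with \<open>z ^ n = 1\<close>, so two monomials with exponents at most
      \<open>s\<close> agree at the point.\<close>
    have "\<not> inj_on (\<lambda>(u, v). x ^ u * y ^ v) ({..s} \<times> {..s})"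
    proof
      assume inj: "inj_on (\<lambda>(u, v). x ^ u * y ^ v) ({..s} \<times> {..s})"
      have "(x ^ u * y ^ v) ^ n = 1" for u v
        using n by (simp add: power_mult_distrib) (metis mult.commute power_mult power_one mult_1)
      hence "(\<lambda>(u, v). x ^ u * y ^ v) ` ({..s} \<times> {..s}) \<subseteq> {z. z ^ n = 1}" by auto
      from card_inj_on_le[OF inj this] n(1) have "card ({..s} \<times> {..s}) \<le> n"
        by (simp add: finite_nth_roots card_nth_roots)
      thus False using s by (simp add: card_cartesian_product power2_eq_square)
    qed
    then obtain u v u' v' where uv: "(u, v) \<noteq> (u', v')" "u \<le> s" "v \<le> s" "u' \<le> s" "v' \<le> s"
      "x ^ u * y ^ v = x ^ u' * y ^ v'" by (auto simp: inj_on_def)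
    define G :: "complex poly poly" where "G = monom (monom 1 u) v - monom (monom 1 u') v'"
    have G: "\<not> F dvd G" unfolding G_def using ndvd uv(1) by blast
    have poly2_G: "poly2 G x y = x ^ u * y ^ v - x ^ u' * y ^ v'" for x y
    proof -
      interpret h: comm_ring_hom "\<lambda>c :: complex poly. poly c x" by unfold_locales auto
      interpret map: map_poly_comm_ring_hom "\<lambda>c :: complex poly. poly c x" ..
      show ?thesis by (simp add: G_def map.hom_minus poly_monom)
    qed
    have degG: "degree (coeff G i) \<le> s" "degree G \<le> s" for i
    proof -
      show "degree (coeff G i) \<le> s" unfolding G_def coeff_diff
        using uv by (intro degree_diff_le) (auto intro: order.trans[OF degree_monom_le])
      show "degree G \<le> s" unfolding G_def
        using uv by (intro degree_diff_le) (auto intro: order.trans[OF degree_monom_le])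
    qed
    \<comment> \<open>\<open>M\<close> is a multiple of \<open>N\<close>, as conjugation demands,
      and of \<open>n\<close>, so that \<open>x\<close> and \<open>y\<close> are powers of one
      primitive \<open>M\<close>-th root.\<close>
    define M where "M = n * N"
    have M: "M > 0" "N dvd M" using n N by (auto simp: M_def)
    define w where "w = cis (2 * pi / real M)"
    have w: "primitive_root_unity M w" unfolding w_def by (rule primitive_root_unity_cis[OF M(1)])
    have "x ^ M = 1" "y ^ M = 1" using n by (simp_all add: M_def power_mult)
    then obtain p q where pq: "x = w ^ p" "y = w ^ q"
      using primitive_root_unity_generates[OF w] by metis
    define J where "J = {j\<in>{..<M}. coprime j M \<and> [j = 1] (mod N)}"
    define pt where "pt = (\<lambda>j. (x ^ j, y ^ j))"
    have zeroF: "poly2 F (x ^ j) (y ^ j) = 0" if "j \<in> J" for j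
    proof -
      \<comment> \<open>With \<open>x = w ^ p\<close> and \<open>y = w ^ q\<close> every monomial is
        a power of \<open>w\<close>. The \<open>j\<close> bound inside \<open>g\<close> is an
        exponent of \<open>x\<close> and hides the conjugating index.\<close>
      define g :: "nat \<times> nat \<Rightarrow> int poly" where "g = (\<lambda>(i, j). monom 1 (p * j + q * i))"
      have *: "(\<Sum>i\<in>I. c i * poly (map_poly of_int (g i)) (w ^ l)) = poly2 F (x ^ l) (y ^ l)" for l
        unfolding poly2_F pq
        by (intro sum.cong) (auto simp: g_def poly_monom algebra_simps simp flip: power_mult power_add)
      have "(\<Sum>i\<in>I. c i * poly (map_poly of_int (g i)) w) = 0" using *[of 1] xy by simp
      from conj[OF M(2) w _ _ this] show ?thesis using that * by (auto simp: J_def)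
    qed
    have zeroG: "poly2 G (x ^ j) (y ^ j) = 0" for j
    proof -
      have "(x ^ u * y ^ v) ^ j = (x ^ u' * y ^ v') ^ j" using uv by simp
      thus ?thesis unfolding poly2_G by (simp add: power_mult_distrib flip: power_mult) (simp add: mult.commute)
    qed
    have "finite J" by (simp add: J_def)
    have "card (pt ` J) \<le> (a + d) * d * s"
      using zeroF zeroG \<open>finite J\<close> degG nz a d
      by (intro card_common_zeros_le[OF irr G]) (auto simp: pt_def d_def)
    \<comment> \<open>Indices giving the same point are congruent modulo \<open>n\<close>, and a
      class has at most \<open>N\<close> members below \<open>n * N\<close>, told apart by
      \<open>j div n\<close>.\<close>
    moreover have "card J \<le> N * card (pt ` J)"
    proof -
      have "card (pt -` {z} \<inter> J) \<le> N" if "z \<in> pt ` J" for z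
      proof -
        have "inj_on (\<lambda>j. j div n) (pt -` {z} \<inter> J)"
        proof (rule linorder_inj_onI)
          fix i j assume ij: "i < j" "i \<in> pt -` {z} \<inter> J" "j \<in> pt -` {z} \<inter> J"
          hence "n dvd j - i" by (intro order) (auto simp: pt_def)
          then obtain l where "j - i = n * l" ..
          hence l: "j = i + n * l" "l > 0" using ij(1) by (auto intro!: gr0I)
          thus "i div n \<noteq> j div n" using n(1) by simp
        qed auto
        moreover have "(\<lambda>j. j div n) ` (pt -` {z} \<inter> J) \<subseteq> {..<N}"
          by (auto simp: J_def M_def less_mult_imp_div_less mult.commute)
        ultimately show ?thesis using card_inj_on_le[of "\<lambda>j. j div n" "pt -` {z} \<inter> J" "{..<N}"] by simp
      qed
      hence "(\<Sum>z\<in>pt ` J. card (pt -` {z} \<inter> J)) \<le> (\<Sum>z\<in>pt ` J. N)" by (intro sum_mono)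
      moreover have "card J \<le> (\<Sum>z\<in>pt ` J. card (pt -` {z} \<inter> J))"
      proof -
        have "J = (\<Union>z\<in>pt ` J. pt -` {z} \<inter> J)" by auto
        thus ?thesis using card_UN_le[of "pt ` J" "\<lambda>z. pt -` {z} \<inter> J"] \<open>finite J\<close> by simp
      qed
      ultimately show ?thesis by (simp add: mult.commute)
    qed
    moreover have "totient M \<le> N * card J"
      unfolding J_def using N M by (intro totient_le_mult_card_cong_1)
    ultimately have "totient M \<le> N * (N * ((a + d) * d * s))"
      by (meson dual_order.trans mult_le_mono2)
    hence tot: "totient M \<le> C * s" by (simp add: C_def power2_eq_square algebra_simps)
    have "M ^ 3 \<le> 16 * totient M ^ 4" by (rule cube_le_totient_power_4[OF M(1)])
    also have "\<dots> \<le> 16 * (C * s) ^ 4" using tot by (intro mult_le_mono2 power_mono) auto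
    also have "\<dots> = B * (s\<^sup>2) ^ 2" by (simp add: B_def power_mult_distrib flip: power_mult)
    also have "\<dots> \<le> B * M ^ 2"
      using s(1) N by (intro mult_le_mono2 power_mono) (auto simp: M_def intro: order.trans)
    finally have "M * M ^ 2 \<le> B * M ^ 2" by (simp add: power3_eq_cube power2_eq_square)
    hence "M \<le> B" using M(1) by simp
    moreover have "n \<le> M" using N by (simp add: M_def)
    ultimately show ?thesis using n by (intro exI[of _ n]) auto
  qed
  have "{(x, y). poly2 F x y = 0 \<and> (\<exists>k>0. x ^ k = 1 \<and> y ^ k = 1)} \<subseteq>
      (\<Union>n\<in>{1..B}. {x. x ^ n = 1} \<times> {y. y ^ n = 1})"
  proof clarify
    fix x y :: complex and k :: nat
    assume "poly2 F x y = 0" "0 < k" "x ^ k = 1" "y ^ k = 1"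
    from bound[OF this] obtain n where "n > 0" "n \<le> B" "x ^ n = 1" "y ^ n = 1" by blast
    thus "(x, y) \<in> (\<Union>n\<in>{1..B}. {x. x ^ n = 1} \<times> {y. y ^ n = 1})"
      by (intro UN_I[of n]) auto
  qed
  thus ?thesis by (rule finite_subset) (auto simp: finite_nth_roots)
qed

section \<open>Polynomials evaluated at matrices\<close>

text \<open>Horner's scheme; the initial zero matrix takes its size from \<open>A\<close>, so the
  zero polynomial needs no separate convention.\<close>

definition poly_mat :: "'a :: comm_ring_1 poly \<Rightarrow> 'a mat \<Rightarrow> 'a mat" where
  "poly_mat f A = fold_coeffs (\<lambda>a B. a \<cdot>\<^sub>m 1\<^sub>m (dim_row A) + A * B) f
     (0\<^sub>m (dim_row A) (dim_row A))"

context
  fixes A :: "'a :: comm_ring_1 mat" and n :: nat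
  assumes A: "A \<in> carrier_mat n n"
begin

lemma poly_mat_0 [simp]: "poly_mat 0 A = 0\<^sub>m n n"
  using A by (auto simp: poly_mat_def)

lemma poly_mat_pCons: "poly_mat (pCons a f) A = a \<cdot>\<^sub>m 1\<^sub>m n + A * poly_mat f A"
\<comment> \<open>\<open>pCons 0 0\<close> is the zero polynomial, for which
  \<open>fold_coeffs\<close> performs no Horner step.\<close>
proof (cases "a = 0 \<and> f = 0")
  case True
  have "0 \<cdot>\<^sub>m 1\<^sub>m n = (0\<^sub>m n n :: 'a mat)" by (intro eq_matI) auto
  with True A show ?thesis by simp
next
  case False
  thus ?thesis using A by (auto simp: poly_mat_def)
qed

lemma poly_mat_carrier [simp]: "poly_mat f A \<in> carrier_mat n n"
proof (induction f)
  case (pCons a f)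
  thus ?case using A by (auto simp: poly_mat_pCons)
qed simp

lemma poly_mat_dim [simp]: "dim_row (poly_mat f A) = n" "dim_col (poly_mat f A) = n"
  by (rule carrier_matD[OF poly_mat_carrier])+

lemma poly_mat_const: "poly_mat [:a:] A = a \<cdot>\<^sub>m 1\<^sub>m n"
  using A by (simp add: poly_mat_pCons)

lemma poly_mat_1: "poly_mat 1 A = 1\<^sub>m n"
  unfolding one_pCons poly_mat_const by (intro eq_matI) auto

lemma poly_mat_add: "poly_mat (f + g) A = poly_mat f A + poly_mat g A"
proof (induction f g rule: poly_induct2)
  case (pCons a f b g)
  have "poly_mat (pCons a f + pCons b g) A = (a + b) \<cdot>\<^sub>m 1\<^sub>m n + A * (poly_mat f A + poly_mat g A)"
    by (simp add: poly_mat_pCons pCons.IH)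
  also have "\<dots> = (a \<cdot>\<^sub>m 1\<^sub>m n + b \<cdot>\<^sub>m 1\<^sub>m n) + (A * poly_mat f A + A * poly_mat g A)"
    using A by (simp add: add_smult_distrib_right_mat[of _ n n] mult_add_distrib_mat[of _ n n _ n])
  also have "\<dots> = poly_mat (pCons a f) A + poly_mat (pCons b g) A"
    using A by (intro eq_matI) (auto simp: poly_mat_pCons)
  finally show ?case .
qed simp

lemma poly_mat_smult: "poly_mat (smult c f) A = c \<cdot>\<^sub>m poly_mat f A"
proof (induction f)
  case 0
  show ?case by auto
next
  case (pCons a f)
  have "poly_mat (smult c (pCons a f)) A = (c * a) \<cdot>\<^sub>m 1\<^sub>m n + A * (c \<cdot>\<^sub>m poly_mat f A)"
    by (simp add: poly_mat_pCons pCons.IH)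
  also have "A * (c \<cdot>\<^sub>m poly_mat f A) = c \<cdot>\<^sub>m (A * poly_mat f A)"
    using A by (simp add: mult_smult_distrib[of _ n n _ n])
  also have "(c * a) \<cdot>\<^sub>m 1\<^sub>m n + \<dots> = c \<cdot>\<^sub>m poly_mat (pCons a f) A"
    using A by (intro eq_matI) (auto simp: poly_mat_pCons algebra_simps)
  finally show ?case .
qed

lemma poly_mat_diff: "poly_mat (f - g) A = poly_mat f A - poly_mat g A"
proof -
  have "f - g = f + smult (-1) g" by simp
  hence "poly_mat (f - g) A = poly_mat f A + (-1) \<cdot>\<^sub>m poly_mat g A"
    by (simp only: poly_mat_add poly_mat_smult)
  also have "\<dots> = poly_mat f A - poly_mat g A" by (intro eq_matI) auto
  finally show ?thesis .
qed

lemma poly_mat_mult: "poly_mat (f * g) A = poly_mat f A * poly_mat g A"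
proof (induction f)
  case 0
  show ?case by (simp add: left_mult_zero_mat[of _ n n])
next
  case (pCons a f)
  have "poly_mat (pCons a f * g) A = poly_mat (smult a g + pCons 0 (f * g)) A" by simp
  also have "\<dots> = a \<cdot>\<^sub>m poly_mat g A + (0 \<cdot>\<^sub>m 1\<^sub>m n + A * (poly_mat f A * poly_mat g A))"
    by (simp only: poly_mat_add poly_mat_smult poly_mat_pCons pCons.IH)
  also have "0 \<cdot>\<^sub>m 1\<^sub>m n + A * (poly_mat f A * poly_mat g A) = A * poly_mat f A * poly_mat g A"
    using A by (subst assoc_mult_mat[of _ n n _ n _ n]) (auto intro!: eq_matI)
  also have "a \<cdot>\<^sub>m poly_mat g A = (a \<cdot>\<^sub>m 1\<^sub>m n) * poly_mat g A"
    by (simp add: mult_smult_assoc_mat[of _ n n _ n] left_mult_one_mat[of _ n n])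
  also have "\<dots> + A * poly_mat f A * poly_mat g A = poly_mat (pCons a f) A * poly_mat g A"
    unfolding poly_mat_pCons using A
    by (intro add_mult_distrib_mat[symmetric, of _ n n _ _ n]) (auto simp: mult_carrier_mat[of _ n n])
  finally show ?case .
qed

lemma poly_mat_linear: "poly_mat [:a, 1:] A = a \<cdot>\<^sub>m 1\<^sub>m n + A"
proof -
  have "1 \<cdot>\<^sub>m 1\<^sub>m n = (1\<^sub>m n :: 'a mat)" by (intro eq_matI) auto
  thus ?thesis using A by (simp only: poly_mat_pCons[of a] poly_mat_const right_mult_one_mat)
qed

lemma poly_mat_monom: "poly_mat (monom 1 k) A = A ^\<^sub>m k"
proof (induction k)
  case 0
  show ?case using A poly_mat_1 by simp
next
  case (Suc k)
  have "monom 1 (Suc k) = monom 1 k * [:0, 1 :: 'a:]" by (simp add: monom_Suc)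
  moreover have "poly_mat [:0, 1:] A = A"
    using A by (subst poly_mat_linear) (auto intro!: eq_matI)
  ultimately show ?case using Suc by (simp only: poly_mat_mult pow_mat.simps)
qed

end

section \<open>Action on vectors, and matrices of finite order\<close>

lemma smult_one_mat_mult_vec:
  fixes v :: "'a :: comm_ring_1 vec"
  assumes "v \<in> carrier_vec n"
  shows "(c \<cdot>\<^sub>m 1\<^sub>m n) *\<^sub>v v = c \<cdot>\<^sub>v v"
proof (rule eq_vecI)
  fix i assume i: "i < dim_vec (c \<cdot>\<^sub>v v)"
  have "((c \<cdot>\<^sub>m 1\<^sub>m n) *\<^sub>v v) $ i = (\<Sum>j = 0..<n. c * (if j = i then 1 else 0) * v $ j)"
    using assms i by (auto simp: scalar_prod_def intro!: sum.cong)
  also have "\<dots> = (\<Sum>j = 0..<n. (if i = j then c * v $ j else 0))"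
    by (intro sum.cong) auto
  also have "\<dots> = c * v $ i" using assms i by simp
  finally show "((c \<cdot>\<^sub>m 1\<^sub>m n) *\<^sub>v v) $ i = (c \<cdot>\<^sub>v v) $ i" using i by simp
qed (use assms in auto)

text \<open>On the chain \<open>A\<close> acts as a + e with e^2 = 0, and f(a + e) = f(a) + f'(a) e.
  Hence, for nonzero \<open>v\<close>, a polynomial with a simple root at \<open>a\<close> cannot
  annihilate \<open>A\<close>.\<close>

lemma poly_mat_jordan_chain:
  fixes A :: "'a :: field mat"
  assumes A: "A \<in> carrier_mat n n" and v: "v \<in> carrier_vec n" "A *\<^sub>v v = a \<cdot>\<^sub>v v"
    and w: "w \<in> carrier_vec n" "A *\<^sub>v w = a \<cdot>\<^sub>v w + v"
  shows "poly_mat f A *\<^sub>v w = poly f a \<cdot>\<^sub>v w + poly (pderiv f) a \<cdot>\<^sub>v v"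
proof (induction f)
  case 0
  show ?case using A v w by (auto intro!: eq_vecI)
next
  case (pCons c f)
  have "poly_mat (pCons c f) A *\<^sub>v w = c \<cdot>\<^sub>v w + A *\<^sub>v (poly_mat f A *\<^sub>v w)"
    unfolding poly_mat_pCons[OF A] using A w
    by (simp add: add_mult_distrib_mat_vec[of _ n n] smult_one_mat_mult_vec
        assoc_mult_mat_vec[OF A poly_mat_carrier[OF A]] mult_carrier_mat[OF A poly_mat_carrier[OF A]])
  also have "A *\<^sub>v (poly_mat f A *\<^sub>v w) =
      poly f a \<cdot>\<^sub>v (a \<cdot>\<^sub>v w + v) + poly (pderiv f) a \<cdot>\<^sub>v (a \<cdot>\<^sub>v v)"
    unfolding pCons.IH using A v w
    by (simp add: mult_add_distrib_mat_vec[of _ n n] mult_mat_vec[of _ n n])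
  also have "c \<cdot>\<^sub>v w + \<dots> = poly (pCons c f) a \<cdot>\<^sub>v w + poly (pderiv (pCons c f)) a \<cdot>\<^sub>v v"
    using v w by (intro eq_vecI) (auto simp: pderiv_pCons algebra_simps)
  finally show ?case .
qed

lemma poly_mat_eigenvector:
  fixes A :: "'a :: field mat"
  assumes A: "A \<in> carrier_mat n n" and v: "v \<in> carrier_vec n" "A *\<^sub>v v = a \<cdot>\<^sub>v v"
  shows "poly_mat f A *\<^sub>v v = poly f a \<cdot>\<^sub>v v"
proof (induction f)
  case 0
  show ?case using A v by (auto intro!: eq_vecI)
next
  case (pCons c f)
  have "poly_mat (pCons c f) A *\<^sub>v v = c \<cdot>\<^sub>v v + A *\<^sub>v (poly_mat f A *\<^sub>v v)"
    unfolding poly_mat_pCons[OF A] using A v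
    by (simp add: add_mult_distrib_mat_vec[of _ n n] smult_one_mat_mult_vec
        assoc_mult_mat_vec[OF A poly_mat_carrier[OF A]] mult_carrier_mat[OF A poly_mat_carrier[OF A]])
  also have "A *\<^sub>v (poly_mat f A *\<^sub>v v) = poly f a \<cdot>\<^sub>v (a \<cdot>\<^sub>v v)"
    unfolding pCons.IH using A v by (simp add: mult_mat_vec[of _ n n])
  also have "c \<cdot>\<^sub>v v + \<dots> = poly (pCons c f) a \<cdot>\<^sub>v v"
    using v by (intro eq_vecI) (auto simp: algebra_simps)
  finally show ?case .
qed

lemma (in comm_ring_hom) poly_mat_hom:
  assumes A: "A \<in> carrier_mat n n"
  shows "map_mat hom (poly_mat f A) = poly_mat (map_poly hom f) (map_mat hom A)"
proof (induction f)
  case 0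
  show ?case using A by (auto simp: poly_mat_0[of _ n])
next
  case (pCons c f)
  interpret map: map_poly_comm_ring_hom hom ..
  have A': "map_mat hom A \<in> carrier_mat n n" using A by simp
  have "map_mat hom (poly_mat (pCons c f) A) =
      map_mat hom (c \<cdot>\<^sub>m 1\<^sub>m n) + map_mat hom A * map_mat hom (poly_mat f A)"
    unfolding poly_mat_pCons[OF A] mat_hom_mult[OF A poly_mat_carrier[OF A], symmetric]
    using A by (intro eq_matI) (auto simp: hom_distribs)
  also have "map_mat hom (c \<cdot>\<^sub>m 1\<^sub>m n) = hom c \<cdot>\<^sub>m 1\<^sub>m n"
    by (intro eq_matI) auto
  finally show ?case unfolding pCons.IH by (simp only: poly_mat_pCons[OF A'] map_poly_pCons_hom)
qed

lemma poly_mat_one_mat: "poly_mat f (1\<^sub>m n) = poly f 1 \<cdot>\<^sub>m 1\<^sub>m n"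
proof (induction f)
  case 0
  show ?case by (auto simp: poly_mat_0[of _ n])
next
  case (pCons c f)
  thus ?case
    by (auto simp: poly_mat_pCons[of _ n] left_mult_one_mat[of _ n n] intro!: eq_matI)
qed

text \<open>Split \<open>f\<close> into linear factors: the determinant is multiplicative, and a
  singular linear factor means that its root is an eigenvalue.\<close>

lemma det_poly_mat_eq_0:
  fixes A :: "'a :: alg_closed_field mat"
  assumes A: "A \<in> carrier_mat n n" and "f \<noteq> 0" "det (poly_mat f A) = 0"
  obtains y where "poly f y = 0" "eigenvalue A y"
proof -
  have "\<exists>y. poly f y = 0 \<and> eigenvalue A y" using assms(2,3)
  proof (induction "degree f" arbitrary: f rule: less_induct)
    case less
    show ?case
    proof (cases "degree f = 0")
      case True
      then obtain c where c: "f = [:c:]" using degree_eq_zeroE by auto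
      thus ?thesis using less.prems A
        by (simp add: poly_mat_const[OF A] det_smult)
    next
      case False
      then obtain y where y: "poly f y = 0" using alg_closed_imp_poly_has_root[of f] by auto
      then obtain g where g: "f = [:-y, 1:] * g" by (auto simp: poly_eq_0_iff_dvd)
      have lin: "poly_mat [:-y, 1:] A = char_matrix A y"
        using A unfolding char_matrix_def
        by (subst poly_mat_linear[OF A]) (auto intro!: eq_matI)
      have "det (char_matrix A y) * det (poly_mat g A) = 0"
        using less.prems(2) unfolding g poly_mat_mult[OF A] lin[symmetric]
        by (simp add: det_mult[OF poly_mat_carrier[OF A] poly_mat_carrier[OF A]])
      hence "eigenvalue A y \<or> det (poly_mat g A) = 0" using eigenvalue_det[OF A] by simp
      moreover have g_nz: "g \<noteq> 0" using less.prems(1) g by auto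
      moreover have "degree g < degree f"
        using degree_mult_eq[of "[:-y, 1:]" g] g_nz unfolding g by simp
      ultimately show ?thesis using less.hyps[of g] y unfolding g poly_mult by auto
    qed
  qed
  thus ?thesis using that by blast
qed

text \<open>At a double root the derivative of x^k - 1 would vanish, which forces the root to be 0;
  but 0 is no root.\<close>

lemma poly_power_minus_one_simple_root:
  fixes u v :: "complex poly"
  assumes "monom 1 k - 1 = u * v" "k > 0" "poly u x = 0"
  shows "poly v x \<noteq> 0"
proof
  assume "poly v x = 0"
  hence "poly (pderiv (u * v)) x = 0" using assms by (simp add: pderiv_mult)
  hence "of_nat k * x ^ (k - 1) = 0"
    unfolding assms(1)[symmetric] by (simp add: pderiv_diff pderiv_monom poly_monom)
  hence "x ^ k = 0" using assms(2) by auto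
  moreover have "poly (monom 1 k - 1) x = 0" unfolding assms(1) using assms(3) by simp
  ultimately show False using assms(2) by (auto simp: poly_monom zero_power)
qed

text \<open>This stands in for the diagonalizability of matrices of finite order. Write x^k - 1 as
  \<open>d * w\<close> with \<open>d\<close> its gcd with \<open>f\<close>: since x^k - 1 has simple
  roots, no eigenvalue is a root of \<open>w\<close>, so \<open>poly_mat w B\<close> is invertible
  and \<open>d\<close> already annihilates \<open>B\<close>.\<close>

lemma poly_mat_eq_0_finite_order:
  fixes B :: "complex mat"
  assumes B: "B \<in> carrier_mat n n" and k: "k > 0" "B ^\<^sub>m k = 1\<^sub>m n"
    and f: "\<And>x. eigenvalue B x \<Longrightarrow> poly f x = 0"
  shows "poly_mat f B = 0\<^sub>m n n"
proof -
  define u :: "complex poly" where "u = monom 1 k - 1"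
  have u0: "poly_mat u B = 0\<^sub>m n n"
    using B k by (simp add: u_def poly_mat_diff[OF B] poly_mat_monom[OF B] poly_mat_1[OF B])
  define d where "d = gcd u f"
  obtain w where w: "u = d * w" unfolding d_def by (meson dvdE gcd_dvd1)
  obtain g where g: "f = d * g" unfolding d_def by (meson dvdE gcd_dvd2)
  have u_nz: "u \<noteq> 0" using k by (auto simp: u_def monom_eq_1_iff)
  have det: "det (poly_mat w B) \<noteq> 0"
  proof
    assume "det (poly_mat w B) = 0"
    then obtain x where x: "poly w x = 0" "eigenvalue B x"
      using det_poly_mat_eq_0[OF B, of w] u_nz w by auto
    have "[:-x, 1:] dvd u" "[:-x, 1:] dvd f"
      using x w f[OF x(2)] unfolding poly_eq_0_iff_dvd[symmetric] by auto
    hence "poly d x = 0" unfolding d_def by (simp add: poly_eq_0_iff_dvd)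
    thus False using poly_power_minus_one_simple_root[of k d w x] w x k by (auto simp: u_def)
  qed
  have "poly_mat w B * poly_mat d B = 0\<^sub>m n n"
    using u0 unfolding w by (simp add: mult.commute[of d] poly_mat_mult[OF B])
  \<comment> \<open>The adjugate cancels \<open>poly_mat w B\<close> up to its nonzero
    determinant.\<close>
  hence "adj_mat (poly_mat w B) * (poly_mat w B * poly_mat d B) = 0\<^sub>m n n"
    using adj_mat(1)[OF poly_mat_carrier[OF B, of w]] by simp
  also have "adj_mat (poly_mat w B) * (poly_mat w B * poly_mat d B) =
      det (poly_mat w B) \<cdot>\<^sub>m poly_mat d B"
    using adj_mat[OF poly_mat_carrier[OF B, of w]] poly_mat_carrier[OF B]
    by (subst assoc_mult_mat[symmetric, of _ n n _ n _ n])
       (auto simp: mult_smult_assoc_mat[of _ n n _ n] left_mult_one_mat[of _ n n])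
  finally have d0: "poly_mat d B = 0\<^sub>m n n"
    using det poly_mat_dim[OF B, of d] by (auto simp: mat_eq_iff)
  have "poly_mat f B = poly_mat d B * poly_mat g B" unfolding g by (rule poly_mat_mult[OF B])
  thus ?thesis using poly_mat_carrier[OF B, of g] by (simp add: d0)
qed

section \<open>Jordan chains\<close>

text \<open>Basis exchange: \<open>v\<close> replaces column 0 of the identity, and the displaced
  unit vector moves to a column \<open>i\<close> with \<open>v $ i \<noteq> 0\<close>, unless
  \<open>i = 0\<close>.\<close>

lemma invertible_mat_with_first_column:
  fixes v :: "'a :: field vec"
  assumes v: "v \<in> carrier_vec n" "v \<noteq> 0\<^sub>v n"
  obtains P Q where "P \<in> carrier_mat n n" "Q \<in> carrier_mat n n" "P * Q = 1\<^sub>m n" "Q * P = 1\<^sub>m n"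
    "P *\<^sub>v unit_vec n 0 = v"
proof -
  obtain i where i: "i < n" "v $ i \<noteq> 0" using v by (metis eq_vecI carrier_vecD index_zero_vec)
  define f where "f = (\<lambda>k j. if j = i then (if k = 0 then 1 else 0) else (if k = j then 1 else 0 :: 'a))"
  define P where "P = mat n n (\<lambda>(k, j). if j = 0 then v $ k else f k j)"
  have P: "P \<in> carrier_mat n n" by (simp add: P_def)
  have Px: "(P *\<^sub>v x) $ k = x $ 0 * v $ k + (if k = i then 0 else if k = 0 then x $ i else x $ k)"
    if x: "x \<in> carrier_vec n" and k: "k < n" for x k
  proof -
    have "(P *\<^sub>v x) $ k = (\<Sum>j\<in>{0..<n}. (if j = 0 then v $ k else f k j) * x $ j)"
      using x k by (simp add: P_def scalar_prod_def)
    also have "{0..<n} = insert 0 {0<..<n}" using i by auto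
    also have "(\<Sum>j\<in>\<dots>. (if j = 0 then v $ k else f k j) * x $ j) =
        v $ k * x $ 0 + (\<Sum>j\<in>{0<..<n}. f k j * x $ j)" by simp
    also have "(\<Sum>j\<in>{0<..<n}. f k j * x $ j) =
        (\<Sum>j\<in>{0<..<n}. if j = (if k = 0 then i else k) then (if k = i then 0 else x $ j) else 0)"
      by (intro sum.cong) (auto simp: f_def)
    also have "\<dots> = (if k = i then 0 else if k = 0 then x $ i else x $ k)"
      using i k by (subst sum.delta) auto
    finally show ?thesis by simp
  qed
  \<comment> \<open>Row \<open>i\<close> of \<open>P\<close> has \<open>v $ i\<close> as its only
    nonzero entry, so a kernel vector has \<open>x $ 0 = 0\<close>; the other rows then kill the
    remaining entries.\<close>
  have "det P \<noteq> 0"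
  proof
    assume "det P = 0"
    then obtain x where x: "x \<in> carrier_vec n" "x \<noteq> 0\<^sub>v n" "P *\<^sub>v x = 0\<^sub>v n"
      using det_0_iff_vec_prod_zero_field[OF P] by auto
    have eq: "x $ 0 * v $ k + (if k = i then 0 else if k = 0 then x $ i else x $ k) = 0" if "k < n" for k
      using Px[OF x(1) that] x(3) that by simp
    have x0: "x $ 0 = 0" using eq[of i] i by simp
    have "x $ k = 0" if "k < n" for k
    proof (cases "k = 0 \<or> k = i")
      case True
      thus ?thesis using eq[of 0] x0 i by (auto split: if_splits)
    next
      case False
      thus ?thesis using eq[of k] x0 that by auto
    qed
    hence "x = 0\<^sub>v n" using x(1) by (intro eq_vecI) auto
    thus False using x(2) by simp
  qed
  define Q where "Q = (1 / det P) \<cdot>\<^sub>m adj_mat P"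
  note adj = adj_mat[OF P]
  have Q: "Q \<in> carrier_mat n n" using adj by (simp add: Q_def)
  have "P * Q = 1\<^sub>m n" "Q * P = 1\<^sub>m n"
    unfolding Q_def using adj P \<open>det P \<noteq> 0\<close>
    by (simp_all add: mult_smult_distrib[of _ n n _ n] mult_smult_assoc_mat[of _ n n _ n])
       (auto intro!: eq_matI)
  moreover have "P *\<^sub>v unit_vec n 0 = v"
  proof (rule eq_vecI)
    fix k assume "k < dim_vec v"
    hence k: "k < n" using v by simp
    show "(P *\<^sub>v unit_vec n 0) $ k = v $ k"
      unfolding Px[OF unit_vec_carrier k] using k i by auto
  qed (use P v in auto)
  ultimately show ?thesis using that[OF P Q] by blast
qed

text \<open>Deflation: an eigenvector as first basis vector makes the matrix block triangular, and
  induction handles the smaller block. The triangular form is the input from which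
  \<open>triangular_to_jnf_vector\<close> produces a Jordan form.\<close>

lemma upper_triangular_exists:
  fixes A :: "'a :: alg_closed_field mat"
  assumes "A \<in> carrier_mat n n"
  shows "\<exists>T. T \<in> carrier_mat n n \<and> upper_triangular T \<and> similar_mat A T"
  using assms
proof (induction n arbitrary: A)
  case 0
  thus ?case by (intro exI[of _ A]) (auto intro: similar_mat_refl)
next
  case (Suc m)
  let ?n = "Suc m"
  note A = Suc.prems
  have "degree (char_poly A) > 0" using degree_monic_char_poly[OF A] by simp
  then obtain a where "poly (char_poly A) a = 0" using alg_closed_imp_poly_has_root by blast
  hence "eigenvalue A a" using eigenvalue_root_char_poly[OF A] by simp
  then obtain v where v: "v \<in> carrier_vec ?n" "v \<noteq> 0\<^sub>v ?n" "A *\<^sub>v v = a \<cdot>\<^sub>v v"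
    using A unfolding eigenvalue_def eigenvector_def by auto
  obtain P Q where PQ: "P \<in> carrier_mat ?n ?n" "Q \<in> carrier_mat ?n ?n" "P * Q = 1\<^sub>m ?n" "Q * P = 1\<^sub>m ?n"
    "P *\<^sub>v unit_vec ?n 0 = v" using invertible_mat_with_first_column[OF v(1,2)] by metis
  define C where "C = Q * A * P"
  have C: "C \<in> carrier_mat ?n ?n" using A PQ by (simp add: C_def)
  have "similar_mat C A"
    using A PQ C by (intro similar_matI[of _ _ Q P ?n]) (auto simp: C_def)
  have Qv: "Q *\<^sub>v v = unit_vec ?n 0"
  proof -
    have "Q *\<^sub>v v = (Q * P) *\<^sub>v unit_vec ?n 0" 
      unfolding assoc_mult_mat_vec[OF PQ(2,1) unit_vec_carrier] PQ(5) ..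
    thus ?thesis unfolding PQ(4) by simp
  qed
  have "C *\<^sub>v unit_vec ?n 0 = Q *\<^sub>v (A *\<^sub>v (P *\<^sub>v unit_vec ?n 0))"
    unfolding C_def using A PQ by (simp add: assoc_mult_mat_vec[of _ ?n ?n _ ?n])
  also have "\<dots> = a \<cdot>\<^sub>v unit_vec ?n 0"
    using PQ v by (simp add: mult_mat_vec[of _ ?n ?n] Qv)
  finally have Ce: "C *\<^sub>v unit_vec ?n 0 = a \<cdot>\<^sub>v unit_vec ?n 0" .
  have col: "C $$ (i, 0) = (if i = 0 then a else 0)" if "i < ?n" for i
  proof -
    have "C $$ (i, 0) = (C *\<^sub>v unit_vec ?n 0) $ i"
      using that C by simp
    thus ?thesis unfolding Ce using that by simp
  qed
  define C1 where "C1 = mat 1 1 (\<lambda>_. a)"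
  define C2 where "C2 = mat 1 m (\<lambda>(i, j). C $$ (i, Suc j))"
  define C4 where "C4 = mat m m (\<lambda>(i, j). C $$ (Suc i, Suc j))"
  have C_eq: "C = four_block_mat C1 C2 (0\<^sub>m m 1) C4"
    using C by (intro eq_matI) (auto simp: C1_def C2_def C4_def col less_Suc_eq_0_disj)
  have C4: "C4 \<in> carrier_mat m m" by (simp add: C4_def)
  obtain T where T: "T \<in> carrier_mat m m" "upper_triangular T" "similar_mat C4 T"
    using Suc.IH[OF C4] by blast
  have C1: "C1 \<in> carrier_mat 1 1" by (simp add: C1_def)
  obtain B0 where B0: "B0 \<in> carrier_mat 1 m"
    "similar_mat C (four_block_mat C1 B0 (0\<^sub>m m 1) T)"
    using similar_mat_four_block_0_ex[OF similar_mat_refl[OF C1] T(3) _ C1 C4, of C2]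
    unfolding C_eq by (auto simp: C2_def)
  have "upper_triangular C1" by (rule upper_triangularI) (simp add: C1_def)
  hence "upper_triangular (four_block_mat C1 B0 (0\<^sub>m m 1) T)"
    using C1 T by (intro upper_triangular_four_block) auto
  moreover have "four_block_mat C1 B0 (0\<^sub>m m 1) T \<in> carrier_mat ?n ?n"
    using four_block_carrier_mat[OF C1 T(1)] by simp
  moreover have "similar_mat A (four_block_mat C1 B0 (0\<^sub>m m 1) T)"
    using \<open>similar_mat C A\<close> B0(2) similar_mat_sym similar_mat_trans by blast
  ultimately show ?case by blast
qed

text \<open>A block of size at least 2 contributes its first two unit vectors, padded by zeros, as a
  chain; without such a block the matrix is diagonal.\<close>

lemma jordan_matrix_diagonal_or_chain:
  fixes n_as :: "(nat \<times> 'a :: field) list"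
  defines "n \<equiv> sum_list (map fst n_as)"
  shows "diagonal_mat (jordan_matrix n_as) \<or> (\<exists>a v w. v \<in> carrier_vec n \<and> w \<in> carrier_vec n \<and> v \<noteq> 0\<^sub>v n \<and>
    jordan_matrix n_as *\<^sub>v v = a \<cdot>\<^sub>v v \<and> jordan_matrix n_as *\<^sub>v w = a \<cdot>\<^sub>v w + v)"
  unfolding n_def
proof (induction n_as)
  case Nil
  show ?case by (simp add: jordan_matrix_def diagonal_mat_def)
next
  case (Cons na n_as)
  obtain k a where na: "na = (k, a)" by (cases na)
  let ?m = "sum_list (map fst n_as)" and ?J = "jordan_matrix n_as" and ?B = "jordan_block k a"
  have J: "?J \<in> carrier_mat ?m ?m" and B: "?B \<in> carrier_mat k k" by simp_all
  have mult: "jordan_matrix (na # n_as) *\<^sub>v (x @\<^sub>v y) = (?B *\<^sub>v x) @\<^sub>v (?J *\<^sub>v y)"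
    if "x \<in> carrier_vec k" "y \<in> carrier_vec ?m" for x y
  proof -
    have "0\<^sub>m k ?m *\<^sub>v y = 0\<^sub>v k" "0\<^sub>m ?m k *\<^sub>v x = 0\<^sub>v ?m"
      using that by (auto intro!: eq_vecI)
    thus ?thesis unfolding na jordan_matrix_Cons using that J B
      by (subst four_block_mat_mult_vec[OF B _ _ J]) auto
  qed
  show ?case
  proof (cases "k \<ge> 2")
    case True
    define v where "v = (unit_vec k 0 @\<^sub>v 0\<^sub>v ?m :: 'a vec)"
    define w where "w = (unit_vec k 1 @\<^sub>v 0\<^sub>v ?m :: 'a vec)"
    have "?B *\<^sub>v unit_vec k 0 = a \<cdot>\<^sub>v unit_vec k 0"
      using True by (intro eq_vecI) auto
    moreover have "?B *\<^sub>v unit_vec k 1 = a \<cdot>\<^sub>v unit_vec k 1 + unit_vec k 0"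
      using True by (intro eq_vecI) auto
    moreover have "?J *\<^sub>v 0\<^sub>v ?m = 0\<^sub>v ?m" using J by (intro eq_vecI) auto
    ultimately have "jordan_matrix (na # n_as) *\<^sub>v v = a \<cdot>\<^sub>v v"
      "jordan_matrix (na # n_as) *\<^sub>v w = a \<cdot>\<^sub>v w + v"
      unfolding v_def w_def by (auto simp: mult intro!: eq_vecI)
    moreover have "v \<in> carrier_vec (k + ?m)" "w \<in> carrier_vec (k + ?m)"
      unfolding v_def w_def by (intro append_carrier_vec unit_vec_carrier zero_carrier_vec)+
    moreover have "v \<noteq> 0\<^sub>v (k + ?m)"
    proof
      assume "v = 0\<^sub>v (k + ?m)"
      hence "v $ 0 = 0" using True by simp
      moreover have "v $ 0 = 1" unfolding v_def using True by simp
      ultimately show False by simp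
    qed
    moreover have "sum_list (map fst (na # n_as)) = k + ?m" by (simp add: na)
    ultimately show ?thesis by metis
  next
    \<comment> \<open>The block has size 0 or 1: it preserves diagonality, and a chain of the
      remaining blocks is padded by zeros in front.\<close>
    case False
    from Cons.IH show ?thesis
    proof
      assume diag: "diagonal_mat ?J"
      have "diagonal_mat (jordan_matrix (na # n_as))"
        using diag False unfolding na jordan_matrix_Cons diagonal_mat_def by auto
      thus ?thesis ..
    next
      assume "\<exists>a v w. v \<in> carrier_vec ?m \<and> w \<in> carrier_vec ?m \<and> v \<noteq> 0\<^sub>v ?m \<and>
        ?J *\<^sub>v v = a \<cdot>\<^sub>v v \<and> ?J *\<^sub>v w = a \<cdot>\<^sub>v w + v"
      then obtain b v w where *: "v \<in> carrier_vec ?m" "w \<in> carrier_vec ?m" "v \<noteq> 0\<^sub>v ?m"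
        "?J *\<^sub>v v = b \<cdot>\<^sub>v v" "?J *\<^sub>v w = b \<cdot>\<^sub>v w + v" by blast
      have B0: "?B *\<^sub>v 0\<^sub>v k = 0\<^sub>v k" using B by (intro eq_vecI) auto
      have "jordan_matrix (na # n_as) *\<^sub>v (0\<^sub>v k @\<^sub>v v) = b \<cdot>\<^sub>v (0\<^sub>v k @\<^sub>v v)"
        "jordan_matrix (na # n_as) *\<^sub>v (0\<^sub>v k @\<^sub>v w) = b \<cdot>\<^sub>v (0\<^sub>v k @\<^sub>v w) + (0\<^sub>v k @\<^sub>v v)"
        using * by (auto simp: mult B0 intro!: eq_vecI)
      moreover have "0\<^sub>v k @\<^sub>v v \<noteq> 0\<^sub>v (k + ?m)"
      proof
        assume eq: "0\<^sub>v k @\<^sub>v v = 0\<^sub>v (k + ?m)"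
        have "v $ i = 0" if "i < ?m" for i
        proof -
          have "(0\<^sub>v k @\<^sub>v v) $ (k + i) = 0" unfolding eq using that by simp
          thus ?thesis using that * by simp
        qed
        hence "v = 0\<^sub>v ?m" using * by (intro eq_vecI) auto
        thus False using * by simp
      qed
      moreover have "0\<^sub>v k @\<^sub>v v \<in> carrier_vec (k + ?m)" "0\<^sub>v k @\<^sub>v w \<in> carrier_vec (k + ?m)"
        using * by (auto intro: append_carrier_vec)
      moreover have "sum_list (map fst (na # n_as)) = k + ?m" by (simp add: na)
      ultimately show ?thesis by metis
    qed
  qed
qed

lemma not_diagonalizable_imp_jordan_chain:
  fixes A :: "'a :: alg_closed_field mat"
  assumes A: "A \<in> carrier_mat n n" and "\<not> diagonalizable_mat A"
  obtains a v w where "v \<in> carrier_vec n" "w \<in> carrier_vec n" "v \<noteq> 0\<^sub>v n"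
    "A *\<^sub>v v = a \<cdot>\<^sub>v v" "A *\<^sub>v w = a \<cdot>\<^sub>v w + v"
proof -
  obtain T where T: "T \<in> carrier_mat n n" "upper_triangular T" "similar_mat A T"
    using upper_triangular_exists[OF A] by blast
  define n_as where "n_as = triangular_to_jnf_vector T"
  define J where "J = jordan_matrix n_as"
  have "similar_mat T J"
    using triangular_to_jnf_vector[OF T(1,2)] by (simp add: jordan_nf_def J_def n_as_def)
  hence AJ: "similar_mat A J" using T(3) similar_mat_trans by blast
  then obtain P Q where "similar_mat_wit A J P Q" unfolding similar_mat_def by blast
  note PQ = similar_mat_witD2[OF A this]
  have n: "sum_list (map fst n_as) = n" using carrier_matD(1)[OF PQ(5)] unfolding J_def jordan_matrix_dim .
  have "\<not> diagonal_mat J" using assms(2) AJ unfolding diagonalizable_mat_def by blast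
  with jordan_matrix_diagonal_or_chain[of n_as] obtain a v w where
    *: "v \<in> carrier_vec n" "w \<in> carrier_vec n" "v \<noteq> 0\<^sub>v n" "J *\<^sub>v v = a \<cdot>\<^sub>v v" "J *\<^sub>v w = a \<cdot>\<^sub>v w + v"
    unfolding n J_def by blast
  have QP: "Q *\<^sub>v (P *\<^sub>v x) = x" if x: "x \<in> carrier_vec n" for x
    using x unfolding assoc_mult_mat_vec[OF PQ(7,6) x, symmetric] PQ(2) by simp
  have A_P: "A *\<^sub>v (P *\<^sub>v x) = P *\<^sub>v (J *\<^sub>v x)" if x: "x \<in> carrier_vec n" for x
  proof -
    have Px: "P *\<^sub>v x \<in> carrier_vec n" using PQ(6) x by simp
    have "A *\<^sub>v (P *\<^sub>v x) = (P * J) *\<^sub>v (Q *\<^sub>v (P *\<^sub>v x))"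
      unfolding PQ(3) by (rule assoc_mult_mat_vec[OF mult_carrier_mat[OF PQ(6,5)] PQ(7) Px])
    also have "\<dots> = P *\<^sub>v (J *\<^sub>v x)"
      unfolding QP[OF x] by (rule assoc_mult_mat_vec[OF PQ(6,5) x])
    finally show ?thesis .
  qed
  have "A *\<^sub>v (P *\<^sub>v v) = a \<cdot>\<^sub>v (P *\<^sub>v v)" "A *\<^sub>v (P *\<^sub>v w) = a \<cdot>\<^sub>v (P *\<^sub>v w) + P *\<^sub>v v"
    using * PQ(6) by (simp_all add: A_P mult_mat_vec[of _ n n] mult_add_distrib_mat_vec[of _ n n])
  moreover have "P *\<^sub>v v \<noteq> 0\<^sub>v n"
  proof
    assume "P *\<^sub>v v = 0\<^sub>v n"
    hence "v = Q *\<^sub>v 0\<^sub>v n" using QP[OF *(1)] by simp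
    also have "\<dots> = 0\<^sub>v n" using PQ by (intro eq_vecI) auto
    finally show False using * by simp
  qed
  moreover have "P *\<^sub>v v \<in> carrier_vec n" "P *\<^sub>v w \<in> carrier_vec n" using PQ * by auto
  ultimately show ?thesis using that by blast
qed

section \<open>Exceptional points\<close>

text \<open>The quotient by the vanishing ideal embeds into a field, so the ideal is prime.\<close>

lemma prime_elem_vanishing_ideal_generator:
  fixes hom :: "'r :: comm_ring_1 \<Rightarrow> 'k :: field"
  assumes "comm_ring_hom hom" and p: "\<And>q. poly (map_poly hom q) a = 0 \<longleftrightarrow> p dvd q" and "p \<noteq> 0"
  shows "prime_elem p"
proof -
  interpret comm_ring_hom hom by fact
  interpret map: map_poly_comm_ring_hom hom ..
  show ?thesis
  proof (rule prime_elemI)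
    show "\<not> p dvd 1" using p[of 1] by simp
    fix x y assume "p dvd x * y"
    hence "poly (map_poly hom (x * y)) a = 0" using p by blast
    thus "p dvd x \<or> p dvd y" using p by (simp add: map.hom_mult)
  qed fact
qed

section \<open>Embedding C[t] into the closure, and specialization at points\<close>

interpretation emb: inj_idom_hom to_ratfun_closure
proof
  fix x :: "complex poly"
  assume "to_ratfun_closure x = 0"
  thus "x = 0" by (simp add: to_ratfun_closure_def Zero_fract_def eq_fract)
qed (auto simp: to_ratfun_closure_def simp flip: Zero_fract_def One_fract_def to_ac_add to_ac_mult)

interpretation emb_poly: map_poly_inj_idom_hom to_ratfun_closure ..

abbreviation spec_mat :: "complex poly mat \<Rightarrow> complex \<Rightarrow> complex mat" where
  "spec_mat A z \<equiv> map_mat (\<lambda>p. poly p z) A"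

lemma spec_hom: "comm_ring_hom (\<lambda>p :: complex poly. poly p z)"
  by unfold_locales auto

lemma eigenvalue_spec_mat_iff:
  assumes "A \<in> carrier_mat r r"
  shows "eigenvalue (spec_mat A z) x \<longleftrightarrow> poly2 (char_poly A) z x = 0"
  using eigenvalue_root_char_poly[of "spec_mat A z" r x] assms
    comm_ring_hom.char_poly_hom[OF spec_hom, of A r z] by simp

lemma eigenvalue_emb_iff:
  assumes "A \<in> carrier_mat r r"
  shows "eigenvalue (map_mat to_ratfun_closure A) x \<longleftrightarrow>
    poly (map_poly to_ratfun_closure (char_poly A)) x = 0"
  using eigenvalue_root_char_poly[of "map_mat to_ratfun_closure A" r x] assms
    emb.char_poly_hom[of A r] by simp

section \<open>The non-diagonalizable case\<close>

lemma finite_order_points_if_not_diagonalizable: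
  assumes A: "A \<in> carrier_mat r r" and nd: "\<not> diagonalizable_mat (map_mat to_ratfun_closure A)"
  shows "finite {z. \<exists>k>0. spec_mat A z ^\<^sub>m k = 1\<^sub>m r}"
proof -
  let ?i = to_ratfun_closure
  let ?AK = "map_mat ?i A"
  have AK: "?AK \<in> carrier_mat r r" using A by simp
  obtain a v w where chain: "v \<in> carrier_vec r" "w \<in> carrier_vec r" "v \<noteq> 0\<^sub>v r"
    "?AK *\<^sub>v v = a \<cdot>\<^sub>v v" "?AK *\<^sub>v w = a \<cdot>\<^sub>v w + v"
    using not_diagonalizable_imp_jordan_chain[OF AK nd] by metis
  define c where "c = char_poly A"
  have c_nz: "c \<noteq> 0" using degree_monic_char_poly[OF A] by (auto simp: c_def)
  have "eigenvalue ?AK a" unfolding eigenvalue_def eigenvector_def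
    using chain AK by (intro exI[of _ v]) auto
  hence ca: "poly (map_poly ?i c) a = 0" using eigenvalue_emb_iff[OF A] by (simp add: c_def)
  obtain p where p: "\<And>q. poly (map_poly ?i q) a = 0 \<longleftrightarrow> p dvd q"
    using vanishing_ideal_principal[OF emb.inj_comm_ring_hom_axioms c_nz ca] by metis
  have "p dvd c" using p ca by blast
  hence p_nz: "p \<noteq> 0" using c_nz by auto
  have prime_p: "prime_elem p"
    by (rule prime_elem_vanishing_ideal_generator[OF emb.comm_ring_hom_axioms p p_nz])
  \<comment> \<open>\<open>prime_factors\<close> consists of normalized elements, hence the
    normalization of the minimal polynomial \<open>p\<close>.\<close>
  define p1 where "p1 = normalize p"
  have p1: "poly (map_poly ?i q) a = 0 \<longleftrightarrow> p1 dvd q" for q using p by (simp add: p1_def)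
  have p1_mem: "p1 \<in> prime_factors c"
    using prime_p \<open>p dvd c\<close> c_nz by (auto simp: p1_def prime_factors_dvd)
  \<comment> \<open>In the radical \<open>f\<close>, only the prime factor \<open>p1\<close>
    vanishes at \<open>a\<close>, which will make \<open>a\<close> a simple root.\<close>
  define f where "f = \<Prod>(prime_factors c)"
  define f1 where "f1 = \<Prod>(prime_factors c - {p1})"
  have f: "f = p1 * f1" unfolding f_def f1_def using p1_mem by (simp add: prod.remove)
  have f1a: "poly (map_poly ?i f1) a \<noteq> 0"
  proof
    assume "poly (map_poly ?i f1) a = 0"
    hence "p1 dvd f1" using p1 by blast
    moreover have "prime p1" using p1_mem by auto
    ultimately obtain q where "q \<in> prime_factors c - {p1}" "p1 dvd q"
      unfolding f1_def by (auto simp: prime_dvd_prod_iff)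
    thus False using \<open>prime p1\<close> primes_dvd_imp_eq by auto
  qed
  have p1a: "poly (map_poly ?i p1) a = 0" using p1 by simp
  have "degree p1 \<noteq> 0"
  proof
    assume "degree p1 = 0"
    then obtain b where "p1 = [:b:]" using degree_eq_zeroE by blast
    thus False using p1a p_nz p1_def by (auto simp: emb.map_poly_pCons_hom)
  qed
  \<comment> \<open>This uses characteristic 0; since \<open>p1\<close> generates the vanishing
    ideal, non-divisibility says that its derivative is nonzero at \<open>a\<close>.\<close>
  hence "\<not> p1 dvd pderiv p1" by (rule not_dvd_pderiv)
  hence "poly (map_poly ?i (pderiv p1)) a \<noteq> 0" using p1 by blast
  hence "poly (map_poly ?i (pderiv f)) a \<noteq> 0"
    using f1a p1a by (simp add: f pderiv_mult emb_poly.hom_mult emb_poly.hom_add)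
  hence fa': "poly (pderiv (map_poly ?i f)) a \<noteq> 0" by (simp add: emb.map_poly_pderiv)
  \<comment> \<open>Applied to the chain vector \<open>w\<close>, \<open>f\<close> evaluated at the
    matrix gives the nonzero multiple f'(a) of \<open>v\<close>.\<close>
  have "poly_mat f A \<noteq> 0\<^sub>m r r"
  proof
    assume "poly_mat f A = 0\<^sub>m r r"
    moreover have "map_mat ?i (0\<^sub>m r r) = 0\<^sub>m r r" by (intro eq_matI) auto
    ultimately have "poly_mat (map_poly ?i f) ?AK = 0\<^sub>m r r"
      using emb.poly_mat_hom[OF A, of f] by simp
    moreover have "poly (map_poly ?i f) a = 0" using p1a by (simp add: f emb_poly.hom_mult)
    ultimately have "0\<^sub>m r r *\<^sub>v w = 0 \<cdot>\<^sub>v w + poly (pderiv (map_poly ?i f)) a \<cdot>\<^sub>v v"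
      using poly_mat_jordan_chain[OF AK chain(1,4,2,5), of "map_poly ?i f"] by simp
    hence *: "(0\<^sub>m r r *\<^sub>v w) $ i = (0 \<cdot>\<^sub>v w + poly (pderiv (map_poly ?i f)) a \<cdot>\<^sub>v v) $ i" for i
      by (rule arg_cong)
    have "v $ i = 0" if "i < r" for i
      using *[of i] that chain fa' by simp
    hence "v = 0\<^sub>v r" using chain(1) by (intro eq_vecI) auto
    thus False using chain(3) by simp
  qed
  then obtain i j where ij: "i < r" "j < r" "poly_mat f A $$ (i, j) \<noteq> 0"
    using poly_mat_dim[OF A, of f] by (auto simp: mat_eq_iff)
  \<comment> \<open>A single nonzero entry suffices: it is a polynomial with finitely many roots,
    and every exceptional point is one of them.\<close>
  have "poly (poly_mat f A $$ (i, j)) z = 0" if k: "k > 0" "spec_mat A z ^\<^sub>m k = 1\<^sub>m r" for z k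
  proof -
    interpret map: map_poly_comm_ring_hom "\<lambda>c :: complex poly. poly c z" ..
    have Az: "spec_mat A z \<in> carrier_mat r r" using A by simp
    have "poly2 f z x = 0" if "eigenvalue (spec_mat A z) x" for x
    proof -
      have "poly2 c z x = 0" using eigenvalue_spec_mat_iff[OF A] that by (simp add: c_def)
      \<comment> \<open>The prime factorization recovers \<open>c\<close> only up to a unit, so
        divisibility replaces equality.\<close>
      moreover have "c dvd prod_mset (prime_factorization c)"
        using prod_mset_prime_factorization_weak[OF c_nz] by (simp add: associated_iff_dvd)
      ultimately have "poly2 (prod_mset (prime_factorization c)) z x = 0"
        by (auto simp: map.hom_mult elim!: dvdE)
      moreover have "\<exists>q\<in>#M. poly2 q z x = 0" if "poly2 (prod_mset M) z x = 0" for M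
        using that by (induction M) (auto simp: map.hom_mult)
      ultimately obtain q where "q \<in> prime_factors c" "poly2 q z x = 0" by blast
      thus ?thesis unfolding f_def by (simp add: prod.remove[of _ q] map.hom_mult)
    qed
    hence "poly_mat (map_poly (\<lambda>c. poly c z) f) (spec_mat A z) = 0\<^sub>m r r"
      by (intro poly_mat_eq_0_finite_order[OF Az k]) auto
    hence "map_mat (\<lambda>c. poly c z) (poly_mat f A) = 0\<^sub>m r r"
      using comm_ring_hom.poly_mat_hom[OF spec_hom A, of z f] by simp
    hence "map_mat (\<lambda>c. poly c z) (poly_mat f A) $$ (i, j) = 0" using ij by simp
    thus ?thesis using ij poly_mat_dim[OF A, of f] by simp
  qed
  hence "{z. \<exists>k>0. spec_mat A z ^\<^sub>m k = 1\<^sub>m r} \<subseteq> {z. poly (poly_mat f A $$ (i, j)) z = 0}" by blast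
  thus ?thesis using poly_roots_finite[OF ij(3)] by (rule finite_subset)
qed


section \<open>The multiplicatively independent case\<close>

abbreviation emb_const :: "complex \<Rightarrow> ratfun_closure" where
  "emb_const c \<equiv> to_ratfun_closure [:c:]"

interpretation emb_const: inj_idom_hom emb_const
  by unfold_locales (auto simp flip: emb.hom_add emb.hom_mult)

interpretation emb_const_poly: map_poly_inj_idom_hom emb_const ..

text \<open>As the complex numbers are algebraically closed, an element outside them is
  transcendental over them: a vanishing polynomial keeps vanishing after removal of each linear
  factor, whose value at \<open>a\<close> is nonzero.\<close>

lemma inj_idom_hom_eval_nonconstant:
  assumes "a \<notin> range emb_const"
  shows "inj_idom_hom (\<lambda>q. poly (map_poly emb_const q) a)"
proof unfold_locales
  fix q :: "complex poly"
  assume "poly (map_poly emb_const q) a = 0"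
  thus "q = 0"
  proof (induction "degree q" arbitrary: q rule: less_induct)
    case less
    show ?case
    proof (cases "degree q = 0")
      case True
      then obtain c where "q = [:c:]" using degree_eq_zeroE by blast
      thus ?thesis using less.prems by (simp add: emb_const.map_poly_pCons_hom)
    next
      case False
      then obtain c where "poly q c = 0" using alg_closed_imp_poly_has_root[of q] by auto
      then obtain g where g: "q = [:-c, 1:] * g" by (auto simp: poly_eq_0_iff_dvd)
      have "(a - emb_const c) * poly (map_poly emb_const g) a = 0"
        using less.prems unfolding g emb_const_poly.hom_mult poly_mult
        by (simp add: emb_const.map_poly_pCons_hom emb_const.hom_uminus)
      moreover have "a - emb_const c \<noteq> 0" using assms by auto
      ultimately have ga: "poly (map_poly emb_const g) a = 0" by simp
      have "g \<noteq> 0 \<Longrightarrow> degree g < degree q"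
        using degree_mult_eq[of "[:-c, 1:]" g] unfolding g by simp
      hence "g = 0" using less.hyps[OF _ ga] by blast
      thus ?thesis using g by simp
    qed
  qed
qed (auto simp: emb_const_poly.hom_add emb_const_poly.hom_mult)

text \<open>The quotient of the two monomials is a relation whose exponents may have either sign,
  which the integer exponents in \<open>mult_independent\<close> cover.\<close>

lemma mult_independent_monomials_inj:
  fixes a b :: "'a :: field"
  assumes ind: "mult_independent a b" and nz: "a \<noteq> 0" "b \<noteq> 0"
    and eq: "a ^ i * b ^ j = a ^ k * b ^ l"
  shows "(i, j) = (k, l)"
proof (rule ccontr)
  assume ne: "(i, j) \<noteq> (k, l)"
  have "a powi (int i - int k) = b powi (int l - int j)"
    using eq nz by (simp add: power_int_diff field_simps)
  thus False using ind ne unfolding mult_independent_def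
    by (metis eq_iff_diff_eq_0 nat_int prod.inject)
qed

text \<open>Modulo the monic equation \<open>c\<close>, the \<open>m\<^sup>2\<close> monomials of bidegree below \<open>m\<close> lie in a complex vector
  space whose dimension is only linear in \<open>m\<close>.\<close>

lemma algebraic_dependence:
  fixes c :: "complex poly poly"
  assumes c: "monic c" "degree c = r" "r > 0"
    and roots: "poly (map_poly to_ratfun_closure c) a = 0" "poly (map_poly to_ratfun_closure c) b = 0"
    and inj: "\<And>i j k l. a ^ i * b ^ j = a ^ k * b ^ l \<Longrightarrow> (i, j) = (k, l)"
  obtains G :: "complex poly poly" where "G \<noteq> 0"
    "poly (map_poly (\<lambda>q. poly (map_poly emb_const q) a) G) b = 0"
proof -
  let ?i = to_ratfun_closure
  let ?scale = "\<lambda>x v. emb_const x * v"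
  interpret V: vector_space ?scale
    by unfold_locales
       (simp_all add: algebra_simps emb_const.hom_add emb_const.hom_mult del: emb.hom_add emb.hom_mult)
  define d where "d = Max ((\<lambda>i. degree (coeff c i)) ` {..r})"
  have d: "degree (coeff c i) \<le> d" if "i < r" for i
    unfolding d_def using that by (intro Max_ge) auto
  \<comment> \<open>\<open>U D\<close> filters the ring generated by \<open>a\<close> and
    \<open>b\<close> over C[t] by degree in t; the monic equation keeps the exponents of
    \<open>a\<close> and \<open>b\<close> below \<open>r\<close>.\<close>
  define g where "g = (\<lambda>(e, k, l). ?i (monom 1 e) * (a ^ k * b ^ l))"
  define U where "U = (\<lambda>D. V.span (g ` ({..D} \<times> {..<r} \<times> {..<r})))"
  have U_mono: "U D \<subseteq> U D'" if "D \<le> D'" for D D'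
    unfolding U_def using that by (intro V.span_mono image_mono) auto
  have poly_U: "?i q * (a ^ k * b ^ l) \<in> U D" if "degree q \<le> D" "k < r" "l < r" for q k l D
  proof -
    have "q = (\<Sum>e\<le>D. [:coeff q e:] * monom 1 e)"
      using poly_as_sum_of_monoms'[OF that(1)] by (simp add: smult_monom)
    hence "?i q = ?i (\<Sum>e\<le>D. [:coeff q e:] * monom 1 e)" by (rule arg_cong)
    also have "\<dots> = (\<Sum>e\<le>D. emb_const (coeff q e) * ?i (monom 1 e))"
      by (simp only: emb.hom_sum emb.hom_mult)
    finally have "?i q * (a ^ k * b ^ l) = (\<Sum>e\<le>D. ?scale (coeff q e) (g (e, k, l)))"
      by (simp only: sum_distrib_right g_def mult.assoc prod.case)
    also have "\<dots> \<in> U D" unfolding U_def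
      using that by (intro V.span_sum V.span_scale V.span_base) auto
    finally show ?thesis .
  qed
  have reduce: "x ^ r = - (\<Sum>s<r. ?i (coeff c s) * x ^ s)" if "poly (map_poly ?i c) x = 0" for x
  proof -
    have "poly (map_poly ?i c) x = (\<Sum>s\<le>r. ?i (coeff c s) * x ^ s)"
      unfolding c(2)[symmetric] by (rule poly_map_poly_altdef) simp
    also have "{..r} = insert r {..<r}" by auto
    also have "(\<Sum>s\<in>\<dots>. ?i (coeff c s) * x ^ s) = x ^ r + (\<Sum>s<r. ?i (coeff c s) * x ^ s)"
      using c by simp
    finally show ?thesis using that by (simp add: add_eq_0_iff2)
  qed
  \<comment> \<open>An exponent that reaches \<open>r\<close> is rewritten by \<open>reduce\<close>,
    whose coefficients raise the degree in t by at most \<open>d\<close>.\<close>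
  have U_mult: "x * v \<in> U (D + d)" if v: "v \<in> U D" and x: "x = a \<or> x = b" for x v D
    using v unfolding U_def
  proof (induction rule: V.span_induct_alt)
    case base
    show ?case by (simp add: V.span_zero)
  next
    case (step y v w)
    then obtain e k l where g: "v = g (e, k, l)" "e \<le> D" "k < r" "l < r" by auto
    have deg: "degree (- (monom 1 e * coeff c s)) \<le> D + d" if "s < r" for s
    proof -
      have "degree (- (monom 1 e * coeff c s)) \<le> degree (monom 1 e :: complex poly) + degree (coeff c s)"
        using degree_mult_le[of "monom 1 e :: complex poly" "coeff c s"] by simp
      thus ?thesis using d[OF that] g(2) degree_monom_le[of "1 :: complex" e] by linarith
    qed
    have dege: "degree (monom 1 e :: complex poly) \<le> D + d"
      using g(2) degree_monom_le[of "1 :: complex" e] by linarith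
    have "x * v \<in> U (D + d)"
      using x
    proof
      assume x: "x = a"
      show ?thesis
      proof (cases "Suc k < r")
        case True
        have "x * v = ?i (monom 1 e) * (a ^ Suc k * b ^ l)" by (simp add: g g_def x)
        thus ?thesis using poly_U[OF dege True g(4)] by simp
      next
        case False
        hence k: "Suc k = r" using g by simp
        have "x * v = ?i (monom 1 e) * (a ^ r * b ^ l)" by (simp add: g g_def x flip: k)
        also have "\<dots> = (\<Sum>s<r. ?i (- (monom 1 e * coeff c s)) * (a ^ s * b ^ l))"
          unfolding reduce[OF roots(1)]
          by (simp add: sum_distrib_left sum_distrib_right sum_negf emb.hom_mult emb.hom_uminus mult.assoc)
        also have "\<dots> \<in> U (D + d)"
          unfolding U_def using deg g by (intro V.span_sum poly_U[unfolded U_def]) auto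
        finally show ?thesis .
      qed
    next
      assume x: "x = b"
      show ?thesis
      proof (cases "Suc l < r")
        case True
        have "x * v = ?i (monom 1 e) * (a ^ k * b ^ Suc l)" by (simp add: g g_def x)
        thus ?thesis using poly_U[OF dege g(3) True] by simp
      next
        case False
        hence l: "Suc l = r" using g by simp
        have "x * v = ?i (monom 1 e) * (a ^ k * b ^ r)" by (simp add: g g_def x flip: l)
        also have "\<dots> = (\<Sum>s<r. ?i (- (monom 1 e * coeff c s)) * (a ^ k * b ^ s))"
          unfolding reduce[OF roots(2)]
          by (simp add: sum_distrib_left sum_distrib_right sum_negf emb.hom_mult emb.hom_uminus mult_ac)
        also have "\<dots> \<in> U (D + d)"
          unfolding U_def using deg g by (intro V.span_sum poly_U[unfolded U_def]) auto
        finally show ?thesis .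
      qed
    qed
    moreover have "x * (?scale y v + w) = ?scale y (x * v) + x * w" by (simp add: algebra_simps)
    ultimately show ?case using step.IH unfolding U_def
      by (simp add: V.span_add V.span_scale)
  qed
  have one_U: "1 \<in> U 0" using poly_U[of 1 0 0 0] c by simp
  have b_U: "b ^ j \<in> U (d * j)" for j
  proof (induction j)
    case (Suc j)
    show ?case using U_mult[OF Suc, of b] by (simp add: add.commute)
  qed (simp add: one_U)
  have ab_U: "a ^ i * b ^ j \<in> U (d * (i + j))" for i j
  proof (induction i)
    case (Suc i)
    show ?case using U_mult[OF Suc, of a] by (simp add: mult.assoc add.commute)
  qed (simp add: b_U)
  \<comment> \<open>Chosen so that the dimension bound \<open>(2 * d * m + 1) * r^2\<close>, at most
    \<open>m * (2 * d + 1) * r^2\<close>, stays below the number \<open>m * m\<close> of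
    monomials.\<close>
  define m where "m = (2 * d + 1) * r\<^sup>2 + 1"
  define S where "S = (\<lambda>(i, j). a ^ i * b ^ j) ` ({..<m} \<times> {..<m})"
  have inj_S: "inj_on (\<lambda>(i, j). a ^ i * b ^ j) ({..<m} \<times> {..<m})"
    using inj by (auto simp: inj_on_def)
  have card_S: "card S = m * m" unfolding S_def by (simp add: card_image[OF inj_S])
  have fin_S: "finite S" by (simp add: S_def)
  have "V.dependent S"
  proof (rule ccontr)
    assume indep: "\<not> V.dependent S"
    have "S \<subseteq> U (d * (2 * m))"
    proof
      fix x assume "x \<in> S"
      then obtain i j where ij: "i < m" "j < m" "x = a ^ i * b ^ j" by (auto simp: S_def)
      have "x \<in> U (d * (i + j))" using ab_U ij by simp
      moreover have "d * (i + j) \<le> d * (2 * m)" using ij by (intro mult_le_mono2) auto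
      ultimately show "x \<in> U (d * (2 * m))" using U_mono by blast
    qed
    hence "card S \<le> card (g ` ({..d * (2 * m)} \<times> {..<r} \<times> {..<r}))"
      using V.independent_span_bound[OF _ indep] unfolding U_def by auto
    also have "\<dots> \<le> card ({..d * (2 * m)} \<times> {..<r} \<times> {..<r})" by (intro card_image_le) auto
    also have "\<dots> = (d * (2 * m) + 1) * r\<^sup>2" by (simp add: card_cartesian_product power2_eq_square)
    also have "\<dots> \<le> m * (2 * d + 1) * r\<^sup>2" by (intro mult_le_mono1) (simp add: m_def algebra_simps)
    also have "\<dots> = m * ((2 * d + 1) * r\<^sup>2)" by (simp only: mult.assoc)
    also have "\<dots> < m * m" by (intro mult_strict_left_mono) (auto simp: m_def)
    finally show False using card_S by simp
  qed
  then obtain u where u: "\<exists>v\<in>S. u v \<noteq> 0" "(\<Sum>v\<in>S. ?scale (u v) v) = 0"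
    unfolding V.dependent_finite[OF fin_S] by blast
  \<comment> \<open>\<open>u\<close> is indexed by values of monomials; these are distinct, so
    summing over exponent pairs meets each term of the dependence exactly once.\<close>
  define G :: "complex poly poly" where
    "G = (\<Sum>j<m. monom (\<Sum>i<m. monom (u (a ^ i * b ^ j)) i) j)"
  have "coeff (coeff G j) i = u (a ^ i * b ^ j)" if "i < m" "j < m" for i j
    using that by (simp add: G_def coeff_sum sum.delta)
  hence "G \<noteq> 0" using u(1) unfolding S_def by force
  moreover have "poly (map_poly (\<lambda>q. poly (map_poly emb_const q) a) G) b = 0"
  proof -
    let ?h = "\<lambda>q. poly (map_poly emb_const q) a"
    interpret h: comm_ring_hom ?h
      by unfold_locales (auto simp: emb_const_poly.hom_add emb_const_poly.hom_mult)
    interpret map: map_poly_comm_ring_hom ?h ..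
    have "poly (map_poly ?h G) b = (\<Sum>j<m. \<Sum>i<m. ?scale (u (a ^ i * b ^ j)) (a ^ i * b ^ j))"
      unfolding G_def map.hom_sum poly_sum
      by (simp add: poly_monom h.hom_sum sum_distrib_right mult.assoc)
    also have "\<dots> = (\<Sum>(i, j)\<in>{..<m} \<times> {..<m}. ?scale (u (a ^ i * b ^ j)) (a ^ i * b ^ j))"
      by (subst sum.swap) (simp add: sum.cartesian_product)
    also have "\<dots> = (\<Sum>v\<in>S. ?scale (u v) v)"
      unfolding S_def by (subst sum.reindex[OF inj_S]) (auto intro!: sum.cong)
    finally show ?thesis using u(2) by simp
  qed
  ultimately show ?thesis using that by blast
qed


lemma eigenvalue_power_eq_1:
  fixes B :: "'a :: field mat"
  assumes B: "B \<in> carrier_mat n n" and "B ^\<^sub>m k = 1\<^sub>m n" "eigenvalue B x"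
  shows "x ^ k = 1"
proof -
  obtain v where v: "eigenvector B v x" using assms(3) unfolding eigenvalue_def by blast
  hence v': "v \<in> carrier_vec n" "v \<noteq> 0\<^sub>v n" using B unfolding eigenvector_def by auto
  have "x ^ k \<cdot>\<^sub>v v = v"
    using eigenvector_pow[OF B v, of k] assms(2) v' by simp
  moreover obtain i where "i < n" "v $ i \<noteq> 0"
    using v' by (metis eq_vecI carrier_vecD index_zero_vec)
  ultimately show ?thesis using v'
    by (metis carrier_vecD index_smult_vec(1) mult_cancel_right1)
qed

lemma poly2_eq_poly_poly: "poly2 F x y = poly (poly F [:y:]) x"
  by (induction F) (auto simp: map_poly_pCons)

text \<open>Otherwise t - x divides \<open>F\<close>; the cofactor still vanishes at
  \<open>a\<close>, hence is divisible by \<open>F\<close>, which would make t - x a unit.\<close>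

lemma vanishing_ideal_generator_specialize_nonzero:
  fixes hom :: "complex poly \<Rightarrow> 'k :: field"
  assumes "inj_comm_ring_hom hom" and F: "\<And>q. poly (map_poly hom q) a = 0 \<longleftrightarrow> F dvd q" and "F \<noteq> 0"
  shows "map_poly (\<lambda>c. poly c x) F \<noteq> 0"
proof
  interpret inj_comm_ring_hom hom by fact
  interpret map: map_poly_inj_comm_ring_hom hom ..
  assume *: "map_poly (\<lambda>c. poly c x) F = 0"
  have "poly (coeff F i) x = 0" for i
    using arg_cong[OF *, of "\<lambda>q. coeff q i"] by (simp add: coeff_map_poly)
  hence "[:[:-x, 1:]:] dvd F" unfolding const_poly_dvd_iff by (simp add: poly_eq_0_iff_dvd)
  then obtain F1 where F1: "F = [:[:-x, 1:]:] * F1" ..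
  have "poly (map_poly hom F) a = 0" using F[of F] by simp
  hence "hom [:-x, 1:] * poly (map_poly hom F1) a = 0"
    by (simp add: F1 map_poly_hom_smult)
  hence "poly (map_poly hom F1) a = 0" by simp
  hence "F dvd F1" using F by blast
  then obtain F2 where "F1 = F * F2" ..
  hence "F * ([:[:-x, 1:]:] * F2) = F * 1" using F1 by (simp add: mult_ac)
  hence "[:[:-x, 1:]:] * F2 = 1" using \<open>F \<noteq> 0\<close> mult_left_cancel by blast
  hence "[:[:-x, 1:]:] dvd (1 :: complex poly poly)" by (metis dvd_triv_left)
  thus False by (simp add: is_unit_poly_iff)
qed

text \<open>Let \<open>p\<close> be the minimal polynomial of \<open>a\<close> over C[t] and
  \<open>F\<close> the relation between \<open>a\<close> and \<open>b\<close>. For nonconstant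
  \<open>a\<close>, an exceptional \<open>z\<close> yields roots of unity with p(z, x) = 0 and F(x,
  y) = 0: torsion leaves finitely many \<open>x\<close>, and \<open>p\<close> finitely many
  \<open>z\<close> for each.\<close>

lemma finite_order_points_if_mult_independent:
  assumes A: "A \<in> carrier_mat r r" and detA: "det A \<noteq> 0"
    and ev: "eigenvalue (map_mat to_ratfun_closure A) a" "eigenvalue (map_mat to_ratfun_closure A) b"
    and ind: "mult_independent a b"
  shows "finite {z. \<exists>k>0. spec_mat A z ^\<^sub>m k = 1\<^sub>m r}"
proof -
  let ?i = to_ratfun_closure
  let ?AK = "map_mat ?i A"
  have AK: "?AK \<in> carrier_mat r r" using A by simp
  define c where "c = char_poly A"
  have c: "monic c" "degree c = r" using degree_monic_char_poly[OF A] by (auto simp: c_def)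
  hence c_nz: "c \<noteq> 0" by auto
  have r: "r > 0" using eigenvalue_imp_nonzero_dim[OF AK ev(1)] .
  have ca: "poly (map_poly ?i c) a = 0" and cb: "poly (map_poly ?i c) b = 0"
    using eigenvalue_emb_iff[OF A] ev by (auto simp: c_def)
  show ?thesis
  proof (cases "a \<in> range emb_const")
    \<comment> \<open>A constant \<open>a\<close> is an eigenvalue at every point, and independence
      with second exponent 0 forbids it to be a root of unity, so there is no exceptional
      point.\<close>
    case True
    then obtain x where x: "a = emb_const x" by auto
    have "?i (poly c [:x:]) = 0" using ca unfolding x by simp
    hence cx: "poly c [:x:] = 0" by simp
    have "False" if k: "k > 0" "spec_mat A z ^\<^sub>m k = 1\<^sub>m r" for z k
    proof -
      have "poly2 c z x = poly (poly c [:x:]) z"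
        by (rule poly2_eq_poly_poly)
      hence "eigenvalue (spec_mat A z) x"
        using eigenvalue_spec_mat_iff[OF A] cx by (simp add: c_def)
      hence "x ^ k = 1" using A k(2) by (intro eigenvalue_power_eq_1[of "spec_mat A z" r]) auto
      hence "a ^ k = 1" unfolding x emb_const.hom_power[symmetric] by simp
      hence "a powi int k = b powi 0" by simp
      thus False using ind k(1) unfolding mult_independent_def by (metis of_nat_eq_0_iff neq0_conv)
    qed
    hence "{z. \<exists>k>0. spec_mat A z ^\<^sub>m k = 1\<^sub>m r} = {}" by blast
    thus ?thesis by (simp only: finite.emptyI)
  next
    case False
    let ?h = "\<lambda>q. poly (map_poly emb_const q) a"
    interpret h: inj_idom_hom ?h by (rule inj_idom_hom_eval_nonconstant[OF False])
    interpret hmap: map_poly_inj_idom_hom ?h ..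
    have nz: "x \<noteq> 0" if "eigenvalue ?AK x" for x
    proof
      assume x0: "x = 0"
      have "det (char_matrix ?AK 0) = 0" using that eigenvalue_det[OF AK] x0 by simp
      moreover have "char_matrix ?AK 0 = ?AK"
        unfolding char_matrix_def using AK by (intro eq_matI) auto
      ultimately have "?i (det A) = 0" by simp
      thus False using detA by simp
    qed
    note mono_inj = mult_independent_monomials_inj[OF ind nz[OF ev(1)] nz[OF ev(2)]]
    obtain G where G: "G \<noteq> 0" "poly (map_poly ?h G) b = 0"
      using algebraic_dependence[OF c r ca cb mono_inj] by metis
    obtain F where F: "\<And>q. poly (map_poly ?h q) b = 0 \<longleftrightarrow> F dvd q"
      using vanishing_ideal_principal[OF h.inj_comm_ring_hom_axioms G] by metis
    have F_nz: "F \<noteq> 0" using F[of G] G by auto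
    have prime_F: "prime_elem F"
      by (rule prime_elem_vanishing_ideal_generator[OF h.comm_ring_hom_axioms F F_nz])
    have Fx: "map_poly (\<lambda>c. poly c x) F \<noteq> 0" for x
      by (rule vanishing_ideal_generator_specialize_nonzero[OF h.inj_comm_ring_hom_axioms F F_nz])
    have deg_F: "degree F > 0"
    proof (rule ccontr)
      assume "\<not> degree F > 0"
      then obtain f where f: "F = [:f:]" using degree_eq_zeroE by auto
      have "poly (map_poly ?h F) b = 0" using F[of F] by simp
      thus False using F_nz by (simp add: f h.map_poly_pCons_hom)
    qed
    have F_monomials: "\<not> F dvd monom (monom 1 i) j - monom (monom 1 k) l" if ne: "(i, j) \<noteq> (k, l)" for i j k l
    proof
      assume "F dvd monom (monom 1 i) j - monom (monom 1 k) l"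
      hence "poly (map_poly ?h (monom (monom 1 i) j - monom (monom 1 k) l)) b = 0" using F by blast
      hence "a ^ i * b ^ j = a ^ k * b ^ l" by (simp add: hmap.hom_minus poly_monom)
      thus False using mono_inj ne by blast
    qed
    define T where "T = {(x, y). poly2 F x y = 0 \<and> (\<exists>k>0. x ^ k = 1 \<and> y ^ k = 1)}"
    have fin_T: "finite T" unfolding T_def
      using prime_elem_imp_irreducible[OF prime_F] deg_F Fx F_monomials by (rule finite_torsion_points)
    obtain p where p: "\<And>q. poly (map_poly ?i q) a = 0 \<longleftrightarrow> p dvd q"
      using vanishing_ideal_principal[OF emb.inj_comm_ring_hom_axioms c_nz ca] by metis
    have "p dvd c" using p ca by blast
    then obtain p' where p': "c = p * p'" ..
    have p_nz: "p \<noteq> 0" using c_nz p' by auto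
    have p_a: "poly (map_poly ?i p) a = 0" using p[of p] by simp
    have lead: "lead_coeff p * lead_coeff p' = 1" using c(1) by (simp add: p' lead_coeff_mult)
    have deg_p: "degree p > 0"
    proof (rule ccontr)
      assume "\<not> degree p > 0"
      then obtain f where f: "p = [:f:]" using degree_eq_zeroE by auto
      show False using p_a p_nz by (simp add: f emb.map_poly_pCons_hom)
    qed
    \<comment> \<open>Otherwise a linear factor with constant root \<open>x\<close> splits off, and
      its cofactor, of smaller degree, still vanishes at the nonconstant \<open>a\<close>. Hence
      each \<open>x\<close> belongs to finitely many \<open>z\<close>.\<close>
    have p_const: "poly p [:x:] \<noteq> 0" for x
    proof
      assume "poly p [:x:] = 0"
      then obtain g where g: "p = [:-[:x:], 1:] * g" by (auto simp: poly_eq_0_iff_dvd)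
      have "(a - emb_const x) * poly (map_poly ?i g) a = 0"
        using p_a unfolding g emb_poly.hom_mult poly_mult
        by (simp add: emb.map_poly_pCons_hom emb_const.hom_uminus)
      moreover have "a - emb_const x \<noteq> 0" using False by auto
      ultimately have "p dvd g" using p by simp
      moreover have "g \<noteq> 0" using p_nz g by auto
      ultimately have "degree p \<le> degree g" by (rule dvd_imp_degree_le)
      moreover have "degree p = 1 + degree g"
        using degree_mult_eq[of "[:-[:x:], 1:]" g] \<open>g \<noteq> 0\<close> unfolding g by simp
      ultimately show False by simp
    qed
    \<comment> \<open>\<open>q\<close> is det F(x, A(t)) in C[t][x]: \<open>psi\<close> makes the
      coefficients of \<open>F\<close> constant in t, and \<open>A'\<close> makes the entries of
      \<open>A\<close> constant in x. Since \<open>p\<close> will divide \<open>q\<close>, each root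
      \<open>x\<close> of \<open>p\<close> at \<open>z\<close> gets a partner \<open>y\<close> among
      the eigenvalues there, with F(x, y) = 0.\<close>
    define psi :: "complex poly \<Rightarrow> complex poly poly" where "psi = map_poly (\<lambda>x. [:x:])"
    define A' where "A' = map_mat (\<lambda>x. [:x:]) A"
    have A': "A' \<in> carrier_mat r r" using A by (simp add: A'_def)
    define q where "q = det (poly_mat (map_poly psi F) A')"
    have q_hom: "e q = det (poly_mat (map_poly (\<lambda>x. e (psi x)) F) (map_mat (\<lambda>x. e [:x:]) A))"
      if e: "comm_ring_hom e" for e :: "complex poly poly \<Rightarrow> 'b :: comm_ring_1"
    proof -
      interpret e: comm_ring_hom e by fact
      have "e q = det (map_mat e (poly_mat (map_poly psi F) A'))" by (simp add: q_def)
      also have "map_mat e (poly_mat (map_poly psi F) A') =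
          poly_mat (map_poly e (map_poly psi F)) (map_mat e A')" by (rule e.poly_mat_hom[OF A'])
      also have "map_poly e (map_poly psi F) = map_poly (\<lambda>x. e (psi x)) F"
        by (subst map_poly_map_poly) (auto simp: o_def psi_def)
      also have "map_mat e A' = map_mat (\<lambda>x. e [:x:]) A" by (auto simp: A'_def intro!: eq_matI)
      finally show ?thesis .
    qed
    \<comment> \<open>F(a, A) kills the eigenvector for \<open>b\<close>, because F(a, b) =
      0.\<close>
    have "poly (map_poly ?i q) a = 0"
    proof -
      have hom: "comm_ring_hom (\<lambda>g. poly (map_poly ?i g) a)"
        by unfold_locales (auto simp: emb_poly.hom_add emb_poly.hom_mult)
      have 1: "poly (map_poly ?i (psi x)) a = ?h x" for x
        unfolding psi_def by (subst map_poly_map_poly) (auto simp: o_def)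
      have 2: "poly (map_poly ?i [:x:]) a = ?i x" for x by (simp add: emb.map_poly_pCons_hom)
      have "poly (map_poly ?i q) a = det (poly_mat (map_poly ?h F) ?AK)"
        using q_hom[OF hom] unfolding 1 2 .
      also have "\<dots> = 0"
      proof -
        obtain v where v: "v \<in> carrier_vec r" "v \<noteq> 0\<^sub>v r" "?AK *\<^sub>v v = b \<cdot>\<^sub>v v"
          using ev(2) AK unfolding eigenvalue_def eigenvector_def by auto
        have "poly_mat (map_poly ?h F) ?AK *\<^sub>v v = poly (map_poly ?h F) b \<cdot>\<^sub>v v"
          by (rule poly_mat_eigenvector[OF AK v(1,3)])
        also have "poly (map_poly ?h F) b = 0" using F[of F] by simp
        also have "0 \<cdot>\<^sub>v v = 0\<^sub>v r" using v by (intro eq_vecI) auto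
        finally show ?thesis
          using det_0_iff_vec_prod_zero_field[OF poly_mat_carrier[OF AK]] v by blast
      qed
      finally show ?thesis .
    qed
    hence "p dvd q" using p by blast
    then obtain q' where q': "q = p * q'" ..
    have "z \<in> (\<Union>x\<in>fst ` T. {z. poly (poly p [:x:]) z = 0})" if k: "k > 0" "spec_mat A z ^\<^sub>m k = 1\<^sub>m r" for z k
    proof -
      let ?e = "\<lambda>c :: complex poly. poly c z"
      interpret e: comm_ring_hom ?e by (rule spec_hom)
      interpret emap: map_poly_comm_ring_hom ?e ..
      have Az: "spec_mat A z \<in> carrier_mat r r" using A by simp
      have pow: "x ^ k = 1" if "eigenvalue (spec_mat A z) x" for x
        using eigenvalue_power_eq_1[OF Az k(2) that] .
      \<comment> \<open>The unit leading coefficient keeps the degree of \<open>p\<close> under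
        specialization, so a root \<open>x\<close> exists at every \<open>z\<close>.\<close>
      have "poly (lead_coeff p) z * poly (lead_coeff p') z = 1"
        using arg_cong[OF lead, of ?e] by simp
      hence "poly (lead_coeff p) z \<noteq> 0" by auto
      hence "degree (map_poly ?e p) = degree p" by (intro degree_map_poly) auto
      then obtain x where x: "poly2 p z x = 0"
        using alg_closed_imp_poly_has_root[of "map_poly ?e p"] deg_p by auto
      hence "poly2 c z x = 0" by (simp add: p' emap.hom_mult)
      hence "eigenvalue (spec_mat A z) x" using eigenvalue_spec_mat_iff[OF A] by (simp add: c_def)
      hence xk: "x ^ k = 1" by (rule pow)
      have "poly2 q z x = 0" using x by (simp add: q' emap.hom_mult)
      moreover have "poly2 q z x = det (poly_mat (map_poly (\<lambda>c. poly c x) F) (spec_mat A z))"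
      proof -
        have hom: "comm_ring_hom (\<lambda>g. poly2 g z x)"
          by unfold_locales (auto simp: emap.hom_add emap.hom_mult)
        have 1: "poly2 (psi g) z x = poly g x" for g
          unfolding psi_def by (subst map_poly_map_poly) (auto simp: o_def)
        have 2: "poly2 [:g:] z x = poly g z" for g by (simp add: poly2_eq_poly_poly)
        show ?thesis using q_hom[OF hom] unfolding 1 2 .
      qed
      ultimately obtain y where y: "poly2 F x y = 0" "eigenvalue (spec_mat A z) y"
        using det_poly_mat_eq_0[OF Az Fx, of x] by auto
      have "(x, y) \<in> T" using xk pow[OF y(2)] y(1) k(1) by (auto simp: T_def)
      moreover have "poly (poly p [:x:]) z = 0"
        using x by (simp add: poly2_eq_poly_poly)
      ultimately show ?thesis by (intro UN_I[of x]) (auto intro: rev_image_eqI)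
    qed
    hence "{z. \<exists>k>0. spec_mat A z ^\<^sub>m k = 1\<^sub>m r} \<subseteq>
        (\<Union>x\<in>fst ` T. {z. poly (poly p [:x:]) z = 0})"
      by (intro subsetI) (elim CollectE exE conjE)
    moreover have "finite (\<Union>x\<in>fst ` T. {z. poly (poly p [:x:]) z = 0})"
      using fin_T p_const by (intro finite_UN_I finite_imageI poly_roots_finite)
    ultimately show ?thesis by (rule finite_subset)
  qed
qed

section \<open>Multiplicities\<close>

lemma pow_mat_add:
  fixes A :: "'a :: comm_ring_1 mat"
  assumes A: "A \<in> carrier_mat n n"
  shows "A ^\<^sub>m (i + j) = A ^\<^sub>m i * A ^\<^sub>m j"
  unfolding poly_mat_monom[OF A, symmetric] poly_mat_mult[OF A, symmetric] by (simp add: mult_monom)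

lemma pow_mat_mult:
  fixes A :: "'a :: comm_ring_1 mat"
  assumes A: "A \<in> carrier_mat n n"
  shows "A ^\<^sub>m (i * j) = (A ^\<^sub>m i) ^\<^sub>m j"
proof (induction j)
  case 0
  show ?case using A by simp
next
  case (Suc j)
  have "A ^\<^sub>m (i * Suc j) = A ^\<^sub>m (i * j) * A ^\<^sub>m i"
    using pow_mat_add[OF A, of "i * j" i] by (simp add: add.commute)
  thus ?case by (simp add: Suc)
qed

lemma one_mat_pow: "(1\<^sub>m n :: 'a :: comm_ring_1 mat) ^\<^sub>m k = 1\<^sub>m n"
  by (induction k) auto

lemma dvd_mat_gcd_iff:
  assumes "B \<in> carrier_mat n n"
  shows "g dvd mat_gcd B \<longleftrightarrow> (\<forall>i<n. \<forall>j<n. g dvd B $$ (i, j))"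
proof -
  have "elements_mat B = {B $$ (i, j) |i j. i < n \<and> j < n}"
    using assms by (auto dest!: elements_matD)
  thus ?thesis unfolding mat_gcd_def dvd_Gcd_iff by auto
qed

lemma poly_mat_gcd_eq_0_iff:
  assumes A: "A \<in> carrier_mat r r"
  shows "poly (mat_gcd (A ^\<^sub>m k - 1\<^sub>m r)) z = 0 \<longleftrightarrow> spec_mat A z ^\<^sub>m k = 1\<^sub>m r"
proof -
  have pow: "spec_mat A z ^\<^sub>m k = spec_mat (A ^\<^sub>m k) z"
    using semiring_hom.mat_hom_pow[OF _ A, of "\<lambda>p. poly p z" k] spec_hom[of z]
    by (simp add: comm_ring_hom_def ring_hom_def)
  have "poly (mat_gcd (A ^\<^sub>m k - 1\<^sub>m r)) z = 0 \<longleftrightarrow>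
      (\<forall>i<r. \<forall>j<r. poly ((A ^\<^sub>m k - 1\<^sub>m r) $$ (i, j)) z = 0)"
    unfolding poly_eq_0_iff_dvd by (rule dvd_mat_gcd_iff[OF minus_carrier_mat[OF one_carrier_mat]])
  also have "\<dots> \<longleftrightarrow> spec_mat (A ^\<^sub>m k) z = 1\<^sub>m r"
    using A by (auto simp: mat_eq_iff)
  finally show ?thesis by (simp add: pow)
qed

text \<open>Multiplying \<open>S * (B - I)\<close> by the adjugate of the cofactor \<open>S\<close>
  shows divisibility for \<open>det S\<close> times each entry of \<open>B - I\<close>; as
  \<open>det S\<close> is nonzero at \<open>z\<close>, it contributes no factor t - z.\<close>

lemma linear_power_dvd_pow_mat_minus_one:
  assumes B: "B \<in> carrier_mat n n" and Bz: "spec_mat B z = 1\<^sub>m n" and q: "q > 0"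
    and dvd: "\<And>i j. i < n \<Longrightarrow> j < n \<Longrightarrow> [:-z, 1:] ^ m dvd (B ^\<^sub>m q - 1\<^sub>m n) $$ (i, j)"
    and ij: "i < n" "j < n"
  shows "[:-z, 1:] ^ m dvd (B - 1\<^sub>m n) $$ (i, j)"
proof -
  define s :: "complex poly poly" where "s = (\<Sum>i<q. [:0, 1:] ^ i)"
  define S where "S = poly_mat s B"
  have S: "S \<in> carrier_mat n n" unfolding S_def by (rule poly_mat_carrier[OF B])
  have B1: "B - 1\<^sub>m n \<in> carrier_mat n n" by (rule minus_carrier_mat[OF one_carrier_mat])
  have Bq: "B ^\<^sub>m q - 1\<^sub>m n \<in> carrier_mat n n" by (rule minus_carrier_mat[OF one_carrier_mat])
  have mon: "s * [:-1, 1:] = monom (1 :: complex poly) q - 1"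
  proof -
    have "monom (1 :: complex poly) q - 1 = [:0, 1:] ^ q - 1" by (simp add: monom_altdef)
    also have "\<dots> = ([:0, 1:] - 1) * s" unfolding s_def by (rule power_diff_1_eq)
    also have "[:0, 1:] - 1 = [:-1, 1 :: complex poly:]"
      by (simp only: one_pCons diff_pCons diff_0 diff_zero)
    finally show ?thesis by (simp only: mult.commute)
  qed
  have "poly_mat [:-1, 1:] B = B - 1\<^sub>m n"
    using B by (subst poly_mat_linear[OF B]) (auto intro!: eq_matI)
  hence "S * (B - 1\<^sub>m n) = poly_mat (s * [:-1, 1:]) B"
    by (simp only: S_def poly_mat_mult[OF B])
  hence SB: "S * (B - 1\<^sub>m n) = B ^\<^sub>m q - 1\<^sub>m n"
    by (simp only: mon poly_mat_diff[OF B] poly_mat_monom[OF B] poly_mat_1[OF B])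
  have "poly (det S) z \<noteq> 0"
  proof -
    have "poly (det S) z = det (spec_mat S z)"
      using comm_ring_hom.hom_det[OF spec_hom, of z S] by simp
    also have "spec_mat S z = poly2 s z 1 \<cdot>\<^sub>m 1\<^sub>m n"
      unfolding S_def comm_ring_hom.poly_mat_hom[OF spec_hom B] Bz by (rule poly_mat_one_mat)
    also have "poly2 s z 1 = of_nat q"
      unfolding poly2_eq_poly_poly s_def by (simp add: poly_sum)
    finally show ?thesis using q by (simp add: det_smult)
  qed
  hence det: "det S \<noteq> 0" "order z (det S) = 0" by (auto simp: order_root)
  have "adj_mat S * (B ^\<^sub>m q - 1\<^sub>m n) = adj_mat S * S * (B - 1\<^sub>m n)"
    unfolding SB[symmetric] by (rule assoc_mult_mat[OF adj_mat(1)[OF S] S B1, symmetric])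
  also have "\<dots> = det S \<cdot>\<^sub>m (B - 1\<^sub>m n)"
    unfolding adj_mat(3)[OF S] using B1 by (simp add: mult_smult_assoc_mat[OF one_carrier_mat B1])
  finally have "det S * (B - 1\<^sub>m n) $$ (i, j) = (adj_mat S * (B ^\<^sub>m q - 1\<^sub>m n)) $$ (i, j)"
    using ij B by simp
  also have "[:-z, 1:] ^ m dvd \<dots>"
    using ij Bq adj_mat(1)[OF S] dvd unfolding index_mult_mat(1)[of i "adj_mat S" j]
    by (auto simp: scalar_prod_def intro!: dvd_sum dvd_mult)
  finally have "[:-z, 1:] ^ m dvd det S * (B - 1\<^sub>m n) $$ (i, j)" .
  thus ?thesis using det order_mult[of "det S" "(B - 1\<^sub>m n) $$ (i, j)" z]
    unfolding order_divides by (cases "(B - 1\<^sub>m n) $$ (i, j) = 0") auto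
qed

text \<open>Complex polynomials split into linear factors, so comparing orders at the roots
  suffices.\<close>

lemma dvd_if_order_le:
  fixes g h :: "complex poly"
  assumes "g \<noteq> 0" "h \<noteq> 0" "\<And>z. poly g z = 0 \<Longrightarrow> order z g \<le> order z h"
  shows "g dvd h"
proof -
  have "g dvd (\<Prod>z | poly g z = 0. [:-z, 1:] ^ order z g)"
    using complex_poly_decompose[of g] assms(1) by (metis dvd_refl leading_coeff_0_iff smult_dvd)
  also have "\<dots> dvd (\<Prod>z | poly h z = 0. [:-z, 1:] ^ order z h)"
  proof (rule prod_dvd_prod_subset2)
    show "finite {z. poly h z = 0}" using assms(2) by (rule poly_roots_finite)
    show "{z. poly g z = 0} \<subseteq> {z. poly h z = 0}"
    proof clarify
      fix z assume "poly g z = 0"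
      hence "order z g > 0" "order z g \<le> order z h" using assms(1,3) order_root by auto
      thus "poly h z = 0" unfolding order_root by simp
    qed
    show "[:-z, 1:] ^ order z g dvd [:-z, 1:] ^ order z h" if "z \<in> {z. poly g z = 0}" for z
      using that assms(3) by (intro le_imp_power_dvd) simp
  qed
  also have "\<dots> dvd h"
    using complex_poly_decompose[of h] by (metis dvd_refl dvd_smult)
  finally show ?thesis .
qed

section \<open>From finitely many exceptional points to the common multiple and primitivity\<close>

theorem theorem1p4:
  fixes A :: "complex poly mat" and r :: nat
  assumes "A \<in> carrier_mat r r"
    and "det A \<noteq> 0"
    and "\<not> diagonalizable_mat (map_mat to_ratfun_closure A) \<or>
         (\<exists>\<alpha> \<beta>. eigenvalue (map_mat to_ratfun_closure A) \<alpha> \<and>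
                eigenvalue (map_mat to_ratfun_closure A) \<beta> \<and>
                mult_independent \<alpha> \<beta>)"
  shows "(\<exists>h :: complex poly. h \<noteq> 0 \<and>
            (\<forall>k :: nat. k \<ge> 1 \<longrightarrow> mat_gcd (A ^\<^sub>m k - 1\<^sub>m r) dvd h)) \<and>
         (primitive_mat A \<longrightarrow>
            (\<exists>D :: nat set. finite D \<and> (\<forall>d\<in>D. d \<ge> 2) \<and>
               (\<forall>k :: nat. k \<ge> 1 \<longrightarrow> k \<notin> (\<Union>d\<in>D. {d * n |n. True}) \<longrightarrow>
                  primitive_mat (A ^\<^sub>m k))))"
proof -
  note A = assms(1)
  define Z where "Z = {z. \<exists>k>0. spec_mat A z ^\<^sub>m k = 1\<^sub>m r}"
  have fin_Z: "finite Z" unfolding Z_def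
    using assms(3) finite_order_points_if_not_diagonalizable[OF A]
      finite_order_points_if_mult_independent[OF A assms(2)] by blast
  define g where "g = (\<lambda>k. mat_gcd (A ^\<^sub>m k - 1\<^sub>m r))"
  have g_root: "poly (g k) z = 0 \<longleftrightarrow> spec_mat A z ^\<^sub>m k = 1\<^sub>m r" for k z
    unfolding g_def by (rule poly_mat_gcd_eq_0_iff[OF A])
  \<comment> \<open>A zero gcd would make every complex number exceptional.\<close>
  have g_nz: "g k \<noteq> 0" if "k > 0" for k
  proof
    assume "g k = 0"
    hence "Z = UNIV" unfolding Z_def using g_root[of k] that by auto
    thus False using fin_Z infinite_UNIV_char_0[where 'a = complex] by simp
  qed
  define d where "d = (\<lambda>z. LEAST k. k > 0 \<and> spec_mat A z ^\<^sub>m k = 1\<^sub>m r)"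
  have d: "d z > 0" "spec_mat A z ^\<^sub>m d z = 1\<^sub>m r" if "z \<in> Z" for z
    using LeastI_ex[of "\<lambda>k. k > 0 \<and> spec_mat A z ^\<^sub>m k = 1\<^sub>m r"] that unfolding Z_def d_def by auto
  \<comment> \<open>Division with remainder: the remainder is again an exponent giving the identity,
    so minimality of \<open>d z\<close> makes it 0.\<close>
  have d_dvd: "z \<in> Z \<and> d z dvd k" if k: "k > 0" "spec_mat A z ^\<^sub>m k = 1\<^sub>m r" for z k
  proof -
    have Az: "spec_mat A z \<in> carrier_mat r r" using A by simp
    have z: "z \<in> Z" using k by (auto simp: Z_def)
    have "spec_mat A z ^\<^sub>m k = (spec_mat A z ^\<^sub>m d z) ^\<^sub>m (k div d z) * spec_mat A z ^\<^sub>m (k mod d z)"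
      unfolding pow_mat_mult[OF Az, symmetric] pow_mat_add[OF Az, symmetric] by simp
    also have "\<dots> = spec_mat A z ^\<^sub>m (k mod d z)"
      unfolding d(2)[OF z] one_mat_pow using Az by (intro left_mult_one_mat[of _ r r]) simp
    finally have one: "spec_mat A z ^\<^sub>m (k mod d z) = 1\<^sub>m r" using k by simp
    have least: "\<not> (m > 0 \<and> spec_mat A z ^\<^sub>m m = 1\<^sub>m r)" if "m < d z" for m
      using that unfolding d_def by (rule not_less_Least)
    have "\<not> k mod d z > 0" using least[OF mod_less_divisor[OF d(1)[OF z], of k]] one by simp
    thus ?thesis using z by auto
  qed
  \<comment> \<open>At \<open>z\<close> every \<open>g k\<close> has at most the multiplicity of
    \<open>g (d z)\<close>, so one exponent per exceptional point serves all
    \<open>k\<close>.\<close>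
  define h where "h = (\<Prod>z\<in>Z. [:-z, 1:] ^ order z (g (d z)))"
  have h_nz: "h \<noteq> 0" using fin_Z by (simp add: h_def)
  have g_dvd_h: "g k dvd h" if k: "k \<ge> 1" for k
  proof (rule dvd_if_order_le)
    show "g k \<noteq> 0" using g_nz k by simp
    show "h \<noteq> 0" by fact
    fix z assume "poly (g k) z = 0"
    hence z: "z \<in> Z" "d z dvd k" using g_root[of k z] d_dvd[of k z] k by simp_all
    then obtain q where q: "k = d z * q" by auto
    define B where "B = A ^\<^sub>m d z"
    have B: "B \<in> carrier_mat r r" using A by (simp add: B_def)
    have Bq: "A ^\<^sub>m k = B ^\<^sub>m q" unfolding q B_def by (rule pow_mat_mult[OF A])
    have "spec_mat B z = 1\<^sub>m r"
    proof -
      \<comment> \<open>Writing \<open>B\<close> as its own first power makes the root criterion for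
        powers applicable to \<open>B\<close>.\<close>
      have "poly (mat_gcd (B ^\<^sub>m 1 - 1\<^sub>m r)) z = 0"
        using g_root[of "d z" z] d(2)[OF z(1)] B by (simp add: g_def B_def[symmetric])
      thus ?thesis using poly_mat_gcd_eq_0_iff[OF B, of 1 z] B by simp
    qed
    moreover have "q > 0" using q k by (auto intro!: gr0I)
    moreover have "\<forall>i<r. \<forall>j<r. [:-z, 1:] ^ order z (g k) dvd (B ^\<^sub>m q - 1\<^sub>m r) $$ (i, j)"
      using order_1[of z "g k"] dvd_mat_gcd_iff[OF minus_carrier_mat[OF one_carrier_mat], of _ "B ^\<^sub>m q" r]
      unfolding g_def Bq by simp
    ultimately have "\<forall>i<r. \<forall>j<r. [:-z, 1:] ^ order z (g k) dvd (B - 1\<^sub>m r) $$ (i, j)"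
      using linear_power_dvd_pow_mat_minus_one[OF B] by blast
    hence "[:-z, 1:] ^ order z (g k) dvd g (d z)"
      unfolding g_def B_def[symmetric]
      by (subst dvd_mat_gcd_iff[OF minus_carrier_mat[OF one_carrier_mat]])
    hence "order z (g k) \<le> order z (g (d z))"
      using g_nz[OF d(1)[OF z(1)]] unfolding order_divides by simp
    also have "order z (g (d z)) \<le> order z h"
    proof -
      have "[:-z, 1:] ^ order z (g (d z)) dvd h"
        unfolding h_def using fin_Z z(1) by (rule dvd_prodI)
      thus ?thesis using h_nz unfolding order_divides by simp
    qed
    finally show "order z (g k) \<le> order z h" .
  qed
  have "\<exists>D :: nat set. finite D \<and> (\<forall>d\<in>D. d \<ge> 2) \<and>
      (\<forall>k :: nat. k \<ge> 1 \<longrightarrow> k \<notin> (\<Union>d\<in>D. {d * n |n. True}) \<longrightarrow> primitive_mat (A ^\<^sub>m k))"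
    if prim: "primitive_mat A"
  \<comment> \<open>The progressions are generated by the orders \<open>d z\<close>; primitivity of
    \<open>A\<close> says that \<open>g 1\<close> has no root, which excludes order 1.\<close>
  proof (intro exI[of _ "d ` Z"] conjI ballI allI impI)
    show "finite (d ` Z)" using fin_Z by simp
  next
    fix e assume "e \<in> d ` Z"
    then obtain z where z: "z \<in> Z" "e = d z" by auto
    have "g 1 = 1" using prim A by (simp add: primitive_mat_def g_def)
    hence "spec_mat A z ^\<^sub>m 1 \<noteq> 1\<^sub>m r" using g_root[of 1 z] by simp
    hence "d z \<noteq> 1" using d(2)[OF z(1)] by metis
    thus "e \<ge> 2" using d(1)[OF z(1)] z(2) by simp
  next
    fix k :: nat
    assume k: "k \<ge> 1" "k \<notin> (\<Union>d\<in>d ` Z. {d * n |n. True})"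
    have "poly (g k) z \<noteq> 0" for z
    proof
      assume "poly (g k) z = 0"
      hence "z \<in> Z" "d z dvd k" using g_root[of k z] d_dvd[of k z] k(1) by simp_all
      thus False using k(2) by (auto elim!: dvdE)
    qed
    \<comment> \<open>Without complex roots the gcd is a nonzero constant, and its normalization
      makes it 1.\<close>
    hence "degree (g k) = 0" using alg_closed_imp_poly_has_root[of "g k"] by auto
    hence "is_unit (g k)" using g_nz[of k] k(1) by (auto simp: is_unit_iff_degree)
    moreover have "normalize (g k) = g k" by (simp add: g_def mat_gcd_def)
    ultimately have "g k = 1" using is_unit_normalize by metis
    thus "primitive_mat (A ^\<^sub>m k)" using A by (simp add: primitive_mat_def g_def)
  qed
  thus ?thesis using h_nz g_dvd_h unfolding g_def by blast
qed

end
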